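(* In the risk model below, suppose Assumption A1 holds and $B_0\in\mathcal S$. Then $$\lim_{u\to\infty}\frac{\psi(u)}{\overline B_0(u)}=\frac{\rho}{1-\rho}.$$
   Context: Risk model: $U_t=u+pt-\sum_{i=1}^{N_t}C_i$ with initial reserve $u>0$, premium rate $p>0$, $C_i$ i.i.d. nonnegative claims with distribution function $B$ and $\mathbb{E}[C_1]<\infty$, independent of the simple point process $N_t$ ($N_0=0$) with arrival times $\tau_i$ and inter-arrival times $T_i=\tau_i-\tau_{i-1}$, $\tau_0=0$. Ruin time $\tau_u:=\inf\{t>0:U_t\le0\}$, infinite-horizon ruin probability $\psi(u):=\mathbb{P}(\tau_u<\infty)$. $\overline F=1-F$; $B_0(x):=\frac{1}{\mathbb{E}[C_1]}\int_0^x\overline B(y)\,dy$. $\mathcal S$ is the class of subexponential distribution functions $F$ on $[0,\infty)$: $\mathbb{P}(X_1+X_2>x)/\mathbb{P}(X_1>x)\to2$ for $X_1,X_2$ i.i.d. $\sim F$. Assumption A1: (i) $(N_t/t\in\cdot)$ satisfies a large deviation principle with rate function $I$ such that $I(x)=0$ iff $x=\mu$; (ii) $I$ is increasing on $[\mu,\infty)$ and decreasing on $[0,\mu]$; (iii) $\rho:=\mu\mathbb{E}[C_1]/p<1$; (iv) there is $\theta>0$ with $\mathbb{E}[e^{\theta\sum_{i=1}^nT_i}]<\infty$ for all $n\in\mathbb{N}$. *)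

theory Defs
  imports "HOL-Probability.Probability"
begin

definition distribution_function_pos :: "(real \<Rightarrow> real) \<Rightarrow> bool" where
  "distribution_function_pos F \<longleftrightarrow>
     mono F \<and> (\<forall>a. continuous (at_right a) F) \<and> (\<forall>x<0. F x = 0) \<and> (F \<longlongrightarrow> 1) at_top"

definition tail :: "(real \<Rightarrow> real) \<Rightarrow> real \<Rightarrow> real" where
  "tail F x = 1 - F x"

text \<open>Class S: F is a distribution function on [0,oo) and, for X1, X2 iid with law F
  (law of X1 + X2 is the convolution of the law of F with itself),
  P(X1+X2 > x) / P(X1 > x) tends to 2.\<close>
definition subexponential :: "(real \<Rightarrow> real) \<Rightarrow> bool" where
  "subexponential F \<longleftrightarrow> distribution_function_pos F \<and>
     ((\<lambda>x. measure (interval_measure F \<star> interval_measure F) {x<..} / tail F x)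
        \<longlongrightarrow> 2) at_top"

definition elog :: "real \<Rightarrow> ereal" where
  "elog x = (if x \<le> 0 then -\<infinity> else ereal (ln x))"

definition rate_function :: "(real \<Rightarrow> ereal) \<Rightarrow> bool" where
  "rate_function I \<longleftrightarrow> (\<forall>x. I x \<ge> 0) \<and> (\<forall>c. closed {x. I x \<le> ereal c})"

definition LDP :: "'a measure \<Rightarrow> (real \<Rightarrow> 'a \<Rightarrow> real) \<Rightarrow> (real \<Rightarrow> ereal) \<Rightarrow> bool" where
  "LDP M Z I \<longleftrightarrow> rate_function I \<and>
     (\<forall>F. closed F \<longrightarrow>
        Limsup at_top (\<lambda>t. ereal (1 / t) * elog (measure M {\<omega>\<in>space M. Z t \<omega> \<in> F}))
          \<le> - (INF x\<in>F. I x)) \<and>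
     (\<forall>G. open G \<longrightarrow>
        Liminf at_top (\<lambda>t. ereal (1 / t) * elog (measure M {\<omega>\<in>space M. Z t \<omega> \<in> G}))
          \<ge> - (INF x\<in>G. I x))"

text \<open>Counting process built from arrival times tau (tau 0 = 0): N_t = #{i >= 1. tau_i <= t}.\<close>
definition count_proc :: "(nat \<Rightarrow> 'a \<Rightarrow> real) \<Rightarrow> real \<Rightarrow> 'a \<Rightarrow> nat" where
  "count_proc \<tau> t \<omega> = card {i. 1 \<le> i \<and> \<tau> i \<omega> \<le> t}"

definition interarrival :: "(nat \<Rightarrow> 'a \<Rightarrow> real) \<Rightarrow> nat \<Rightarrow> 'a \<Rightarrow> real" where
  "interarrival \<tau> i \<omega> = \<tau> i \<omega> - \<tau> (i - 1) \<omega>"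

definition surplus :: "real \<Rightarrow> real \<Rightarrow> (nat \<Rightarrow> 'a \<Rightarrow> real) \<Rightarrow> (nat \<Rightarrow> 'a \<Rightarrow> real)
    \<Rightarrow> real \<Rightarrow> 'a \<Rightarrow> real" where
  "surplus u p C \<tau> t \<omega> = u + p * t - (\<Sum>i = 1..count_proc \<tau> t \<omega>. C i \<omega>)"

definition ruin_time :: "real \<Rightarrow> real \<Rightarrow> (nat \<Rightarrow> 'a \<Rightarrow> real) \<Rightarrow> (nat \<Rightarrow> 'a \<Rightarrow> real)
    \<Rightarrow> 'a \<Rightarrow> ereal" where
  "ruin_time u p C \<tau> \<omega> = Inf {ereal t | t. t > 0 \<and> surplus u p C \<tau> t \<omega> \<le> 0}"

definition ruin_prob :: "'a measure \<Rightarrow> real \<Rightarrow> real \<Rightarrow> (nat \<Rightarrow> 'a \<Rightarrow> real)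
    \<Rightarrow> (nat \<Rightarrow> 'a \<Rightarrow> real) \<Rightarrow> real" where
  "ruin_prob M u p C \<tau> = measure M {\<omega>\<in>space M. ruin_time u p C \<tau> \<omega> < \<infinity>}"

definition claim_cdf :: "'a measure \<Rightarrow> (nat \<Rightarrow> 'a \<Rightarrow> real) \<Rightarrow> real \<Rightarrow> real" where
  "claim_cdf M C x = measure M {\<omega>\<in>space M. C 1 \<omega> \<le> x}"

definition integrated_tail :: "'a measure \<Rightarrow> (nat \<Rightarrow> 'a \<Rightarrow> real) \<Rightarrow> real \<Rightarrow> real" where
  "integrated_tail M C x =
     (1 / (\<integral>\<omega>. C 1 \<omega> \<partial>M)) * (LINT y:{0..x}|lborel. tail (claim_cdf M C) y)"

end

theory Submission
  imports Defs
begin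

text \<open>
  Ruin means that \<open>S k - p * \<tau> k\<close> reaches \<open>u\<close> for some \<open>k \<ge> 1\<close>, where \<open>S k\<close> is the sum of the first
  \<open>k\<close> claims. The large deviation principle makes \<open>\<tau> k \<le> k / a\<close> exponentially unlikely in \<open>k\<close>
  for every \<open>a > \<mu>\<close>. So, up to an independent light-tailed error, the arrivals may be replaced
  by deterministic ones with spacing \<open>c < p / \<mu>\<close> in premium units, and the upper bound reduces to the
  maximum of the random walk \<open>S k - k * c\<close>. Integrating the one-step inequality for the tail \<open>G\<close> of this
  maximum gives the renewal inequality \<open>G v \<le> (m / c) * \<integral> G (v - y) dB\<^sub>0(y)\<close> with \<open>m\<close> the mean claim,
  and subexponentiality of \<open>B\<^sub>0\<close> turns it into \<open>limsup G / (1 - B\<^sub>0) \<le> r / (1 - r)\<close> for \<open>r = m / c\<close>;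
  finally \<open>c\<close> tends to \<open>p / \<mu>\<close>. The lower bound sums over the index of a single big claim that causes ruin
  while everything before it has followed the law of large numbers.
\<close>

section \<open>Subexponential tails and renewal inequalities\<close>

text \<open>The inter-arrival times may be dependent, so the surplus seen at claim times is no
  random walk and has no renewal structure. The arrivals are therefore moved into an error
  independent of the claims, and a walk is formed from the i.i.d. claims alone. This costs nothing
  at first order because a subexponential tail decays more slowly than every exponential: lowering
  the level by \<open>j\<close> costs a factor of order \<open>exp (\<eta> * j)\<close> with
  \<open>\<eta>\<close> as small as desired, while an error of size \<open>j\<close> has probability
  of order \<open>exp (- \<kappa> * j)\<close> with \<open>\<kappa>\<close> fixed. Stability leaves
  room for a spacing \<open>c\<close> with \<open>m < c\<close> and \<open>\<mu> < p / c\<close>.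

  Two obstacles shape the walk estimates. Integrating the one-step inequality requires a tail known
  to vanish at infinity, which is clear only for finitely many steps; hence finite-horizon maxima,
  with the supremum over the horizon taken after the integration. And the renewal inequality yields
  \<open>s \<le> r * (1 + s)\<close> for the limsup \<open>s\<close>, which says nothing if
  \<open>s\<close> is infinite; so a crude bound by a multiple of the tail has to come
  first.\<close>

lemma borel_measurable_antimono:
  fixes H :: "real \<Rightarrow> real"
  assumes "\<And>x y. x \<le> y \<Longrightarrow> H y \<le> H x"
  shows "H \<in> borel_measurable borel"
proof -
  have "(\<lambda>x. - H x) \<in> borel_measurable borel"
    by (rule borel_measurable_mono) (auto simp: mono_def assms)
  then show ?thesis by (simp add: borel_measurable_uminus_eq)
qed

locale subexponential_distribution =
  fixes F :: "real \<Rightarrow> real"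
  assumes subexponential: "subexponential F"
begin

abbreviation T :: "real \<Rightarrow> real" where "T \<equiv> tail F"
abbreviation N :: "real measure" where "N \<equiv> interval_measure F"

lemma F_mono: "x \<le> y \<Longrightarrow> F x \<le> F y"
  and F_right_cont: "continuous (at_right a) F"
  and F_neg: "x < 0 \<Longrightarrow> F x = 0"
  and F_at_top: "(F \<longlongrightarrow> 1) at_top"
  using subexponential
  by (auto simp: subexponential_def distribution_function_pos_def mono_def)

lemma F_at_bot: "(F \<longlongrightarrow> 0) at_bot"
proof (rule tendsto_eventually)
  show "\<forall>\<^sub>F x in at_bot. F x = 0"
    unfolding eventually_at_bot_linorder by (intro exI[of _ "-1"]) (auto simp: F_neg)
qed

sublocale N: real_distribution N
  by (rule real_distribution_interval_measure[OF F_mono F_right_cont F_at_bot F_at_top])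

lemma measure_N_atMost: "measure N {..x} = F x"
  by (rule measure_interval_measure_Iic[OF F_mono F_right_cont F_at_bot])

lemma measure_N_greaterThan: "measure N {x<..} = T x"
proof -
  have "{x<..} = space N - {..x}" by auto
  then show ?thesis
    using N.prob_compl[of "{..x}"] by (simp add: measure_N_atMost tail_def)
qed

lemma measure_N_Ioc: "a \<le> b \<Longrightarrow> measure N {a<..b} = T a - T b"
  using measure_interval_measure_Ioc[OF _ F_mono F_right_cont, of a b] by (simp add: tail_def)

lemma AE_N_nonneg: "AE y in N. 0 \<le> y"
proof -
  have "(F \<longlongrightarrow> 0) (at_left 0)"
    by (rule tendsto_eventually) (auto simp: eventually_at_filter F_neg)
  moreover have "(F \<longlongrightarrow> measure N {..<0}) (at_left 0)"
    using N.cdf_at_left[of 0] cdf_interval_measure[OF F_mono F_right_cont F_at_bot] by simp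
  ultimately have "measure N {..<0} = 0"
    by (rule tendsto_unique[OF trivial_limit_at_left_real, rotated])
  then have "emeasure N {..<0} = 0"
    by (simp add: N.emeasure_eq_measure)
  then show ?thesis
    by (intro AE_I[where N="{..<0}"]) auto
qed

lemma T_antimono: "x \<le> y \<Longrightarrow> T y \<le> T x"
  using F_mono by (simp add: tail_def)

lemma T_nonneg: "0 \<le> T x"
  by (metis measure_N_greaterThan measure_nonneg)

lemma T_le_1: "T x \<le> 1"
  by (metis measure_N_greaterThan N.prob_le_1)

lemma T_neg: "x < 0 \<Longrightarrow> T x = 1"
  by (simp add: tail_def F_neg)

lemma T_at_top: "(T \<longlongrightarrow> 0) at_top"
  using tendsto_diff[OF tendsto_const[of 1] F_at_top] by (simp add: tail_def[abs_def])

lemma borel_T [measurable]: "T \<in> borel_measurable borel"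
  by (rule borel_measurable_antimono) (rule T_antimono)

lemma integrable_bounded:
  assumes "f \<in> borel_measurable borel" "\<And>x. \<bar>f x\<bar> \<le> (B::real)"
  shows "integrable N f"
  by (rule N.integrable_const_bound[of _ B]) (use assms in auto)

lemma integrable_T_shift: "integrable N (\<lambda>y. T (v - y))"
  by (rule integrable_bounded[of _ 1]) (auto simp: T_nonneg T_le_1)

text \<open>Since \<open>T\<close> equals \<open>1\<close> on the negative axis, the integral runs over the whole line.\<close>

lemma convolution_tail: "measure (N \<star> N) {v<..} = (\<integral>y. T (v - y) \<partial>N)"
proof -
  have "emeasure (N \<star> N) {v<..} = (\<integral>\<^sup>+ x. emeasure N {a. a + x \<in> {v<..}} \<partial>N)"
    by (rule convolution_emeasure) (auto intro: N.finite_measure_axioms)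
  also have "\<dots> = (\<integral>\<^sup>+ x. ennreal (T (v - x)) \<partial>N)"
  proof (rule nn_integral_cong)
    fix x :: real
    have "{a. a + x \<in> {v<..}} = {v - x<..}" by auto
    then show "emeasure N {a. a + x \<in> {v<..}} = ennreal (T (v - x))"
      by (simp add: N.emeasure_eq_measure measure_N_greaterThan)
  qed
  also have "\<dots> = ennreal (\<integral>y. T (v - y) \<partial>N)"
    by (rule nn_integral_eq_integral[OF integrable_T_shift]) (simp add: T_nonneg)
  finally show ?thesis
    by (simp add: measure_def T_nonneg integral_nonneg_AE)
qed

lemma convolution_ratio: "((\<lambda>v. (\<integral>y. T (v - y) \<partial>N) / T v) \<longlongrightarrow> 2) at_top"
  using subexponential by (simp add: subexponential_def convolution_tail)

lemma T_pos: "0 < T x"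
proof (rule ccontr)
  assume "\<not> 0 < T x"
  then have "T x = 0" using T_nonneg[of x] by simp
  then have "T v = 0" if "x \<le> v" for v
    using T_antimono[OF that] T_nonneg[of v] by simp
  \<comment> \<open>Division by zero yields 0, so a tail that vanishes from some point on would give
    the ratio the limit 0 instead of 2.\<close>
  then have "\<forall>\<^sub>F v in at_top. (\<integral>y. T (v - y) \<partial>N) / T v = 0"
    unfolding eventually_at_top_linorder by (intro exI[of _ x]) auto
  then have "((\<lambda>v. (\<integral>y. T (v - y) \<partial>N) / T v) \<longlongrightarrow> 0) at_top"
    by (rule tendsto_eventually)
  from tendsto_unique[OF _ this convolution_ratio] show False by simp
qed

text \<open>The limit 2 leaves no room: \<open>y > v\<close> contributes \<open>T v\<close>,
  \<open>y \<le> K\<close> at least \<open>T v * F K\<close>, and \<open>K < y \<le> v\<close> at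
  least \<open>T (v - K) * (F v - F K)\<close>. Solving for \<open>T (v - K) / T v\<close> gives an
  upper bound that tends to 1.\<close>

lemma long_tailed:
  assumes K: "0 \<le> K"
  shows "((\<lambda>v. T (v - K) / T v) \<longlongrightarrow> 1) at_top"
proof (rule tendsto_sandwich)
  show "\<forall>\<^sub>F v in at_top. 1 \<le> T (v - K) / T v"
    using K by (auto intro!: always_eventually simp: T_pos le_divide_eq T_antimono)
  let ?Q = "\<lambda>v. (\<integral>y. T (v - y) \<partial>N) / T v"
  have FK: "F K < 1" using T_pos[of K] by (simp add: tail_def)
  then have ev: "\<forall>\<^sub>F v in at_top. F K < F v"
    using order_tendstoD(1)[OF F_at_top] by blast
  show "\<forall>\<^sub>F v in at_top. T (v - K) / T v \<le> (?Q v - 1 - F K) / (F v - F K)"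
    using ev eventually_ge_at_top[of K]
  proof eventually_elim
    case (elim v)
    let ?i = "\<lambda>y. indicator {v<..} y + (T v * indicator {..K} y + T (v - K) * indicator {K<..v} y)"
    have int: "integrable N (indicator A :: real \<Rightarrow> real)" if "A \<in> sets borel" for A
      using that by (intro integrable_bounded[of _ 1]) (auto simp: indicator_def)
    have "(\<integral>y. ?i y \<partial>N) \<le> (\<integral>y. T (v - y) \<partial>N)"
    proof (rule integral_mono_AE)
      show "AE y in N. ?i y \<le> T (v - y)"
        using AE_N_nonneg by eventually_elim
          (use elim in \<open>auto simp: indicator_def T_neg intro!: T_antimono\<close>)
      show "integrable N ?i"
        by (intro Bochner_Integration.integrable_add integrable_mult_right int) auto
    qed (rule integrable_T_shift)
    moreover have "(\<integral>y. ?i y \<partial>N) = T v + T v * F K + T (v - K) * (F v - F K)"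
    proof -
      have "(\<integral>y. ?i y \<partial>N) = measure N {v<..} + (T v * measure N {..K} + T (v - K) * measure N {K<..v})"
        by (subst Bochner_Integration.integral_add;
            (intro Bochner_Integration.integrable_add integrable_mult_right int)?)
          (simp_all add: int)
      then show ?thesis
        using elim measure_N_Ioc[of K v]
        by (simp add: measure_N_greaterThan measure_N_atMost tail_def)
    qed
    ultimately have "T v + T v * F K + T (v - K) * (F v - F K) \<le> ?Q v * T v"
      using T_pos[of v] by simp
    moreover have "(1 + F K + q / t * d) * t = t + t * F K + q * d" if "0 < t" for t q d :: real
      using that by (simp add: field_simps)
    ultimately have "(1 + F K + T (v - K) / T v * (F v - F K)) * T v \<le> ?Q v * T v"
      using T_pos[of v] by (simp only:)
    then have "1 + F K + T (v - K) / T v * (F v - F K) \<le> ?Q v"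
      using T_pos[of v] by (simp only: mult_le_cancel_right_pos)
    then show ?case
      using elim by (simp add: pos_le_divide_eq)
  qed
  have "((\<lambda>v. (?Q v - 1 - F K) / (F v - F K)) \<longlongrightarrow> (2 - 1 - F K) / (1 - F K)) at_top"
    using FK by (intro tendsto_intros convolution_ratio F_at_top) simp
  then show "((\<lambda>v. (?Q v - 1 - F K) / (F v - F K)) \<longlongrightarrow> 1) at_top"
    using FK by simp
qed auto

text \<open>Beyond some \<open>w\<close> each unit step down multiplies the tail by at most
  \<open>exp \<eta>\<close>, by long-tailedness with shift 1. Below \<open>w\<close> the tail is at
  least \<open>T w\<close>, so the constant \<open>1 / T w\<close> absorbs whatever happens
  there.\<close>

lemma exponential_lower_bound:
  assumes \<eta>: "0 < \<eta>"
  obtains A where "0 < A" "\<And>u j. 0 \<le> u \<Longrightarrow> T (u - real j) \<le> A * exp (\<eta> * real j) * T u"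
proof -
  have "\<forall>\<^sub>F v in at_top. T (v - 1) / T v < exp \<eta>"
    using order_tendstoD(2)[OF long_tailed[of 1]] \<eta> by simp
  then obtain u0 where u0: "\<And>v. u0 \<le> v \<Longrightarrow> T (v - 1) / T v < exp \<eta>"
    by (auto simp: eventually_at_top_linorder)
  define w where "w = max u0 0"
  have step: "T (v - 1) \<le> exp \<eta> * T v" if "w \<le> v" for v
    using u0[of v] that T_pos[of v] by (simp add: w_def divide_less_eq)
  \<comment> \<open>Only the point from which the last step is taken, \<open>u - j + 1\<close>, has
    to lie beyond \<open>w\<close>.\<close>
  have iter: "T (u - real j) \<le> exp (\<eta> * real j) * T u" if "w \<le> u - real j + 1" for u j
    using that
  proof (induction j)
    case (Suc j)
    have "T (u - real (Suc j)) = T ((u - real j) - 1)" by (simp add: algebra_simps)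
    also have "\<dots> \<le> exp \<eta> * T (u - real j)" using Suc.prems by (intro step) simp
    also have "\<dots> \<le> exp \<eta> * (exp (\<eta> * real j) * T u)"
      using Suc by (intro mult_left_mono) auto
    finally show ?case by (simp add: algebra_simps exp_add)
  qed simp
  show thesis
  proof (rule that[of "1 / T w"])
    show "0 < 1 / T w" by (simp add: T_pos)
    have ge1: "1 \<le> 1 / T w" by (simp add: T_pos T_le_1)
    fix u :: real and j :: nat assume u: "0 \<le> u"
    show "T (u - real j) \<le> 1 / T w * exp (\<eta> * real j) * T u"
    proof (cases "w \<le> u - real j + 1")
      case True
      have "T (u - real j) \<le> 1 * (exp (\<eta> * real j) * T u)" using iter[OF True] by simp
      also have "\<dots> \<le> 1 / T w * (exp (\<eta> * real j) * T u)"
        by (intro mult_right_mono ge1) (simp add: T_nonneg)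
      finally show ?thesis by (simp add: mult.assoc)
    next
      case False
      show ?thesis
      proof (cases "u \<le> w")
        case True
        have "1 \<le> 1 / T w * T u" using T_antimono[OF True] by (simp add: T_pos)
        moreover have "1 / T w * T u \<le> 1 / T w * T u * exp (\<eta> * real j)"
          using \<eta> T_nonneg[of u] T_nonneg[of w]
            mult_left_mono[of 1 "exp (\<eta> * real j)" "1 / T w * T u"] by simp
        ultimately show ?thesis using T_le_1[of "u - real j"] by (simp add: mult_ac)
      next
        case uw: False
        \<comment> \<open>Stepping stops at the first integer step that reaches \<open>w\<close> or
          passes below it; the remaining steps are covered by
          \<open>T (u - j) \<le> 1\<close>.\<close>
        define i where "i = nat \<lceil>u - w\<rceil>"
        have i: "u - w \<le> real i" "real i < u - w + 1" using uw ceiling_correct[of "u - w"] by (simp_all add: i_def)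
        have "i \<le> j" using i False by linarith
        have "T w \<le> T (u - real i)" using i by (intro T_antimono) simp
        also have "\<dots> \<le> exp (\<eta> * real i) * T u" using i by (intro iter) simp
        also have "\<dots> \<le> exp (\<eta> * real j) * T u"
          using \<open>i \<le> j\<close> \<eta> by (intro mult_right_mono) (auto simp: T_nonneg)
        finally have "1 \<le> 1 / T w * (exp (\<eta> * real j) * T u)" by (simp add: T_pos)
        then show ?thesis using T_le_1[of "u - real j"] by (simp add: mult_ac)
      qed
    qed
  qed
qed

section \<open>Defective renewal inequalities with a subexponential kernel\<close>

text \<open>The supremum \<open>S\<close> of \<open>G / T\<close> over \<open>{..t}\<close> is
  finite because \<open>T t > 0\<close>, and feeding it into the inequality bounds \<open>S\<close>
  by a contraction of itself. The resulting bound does not depend on \<open>t\<close>.\<close>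

lemma renewal_inequality_bounded:
  fixes G :: "real \<Rightarrow> real"
  assumes G_mono: "\<And>x y. x \<le> y \<Longrightarrow> G y \<le> G x"
    and G_nonneg: "\<And>x. 0 \<le> G x" and G_le_1: "\<And>x. G x \<le> 1"
    and r: "0 \<le> r" "r < 1"
    and ineq: "\<And>v. v0 \<le> v \<Longrightarrow> G v \<le> r * (\<integral>y. G (v - y) \<partial>N)"
  obtains D where "1 \<le> D" "\<And>u. G u \<le> D * T u"
proof -
  have [measurable]: "G \<in> borel_measurable borel"
    using G_mono by (rule borel_measurable_antimono)
  \<comment> \<open>The slack for the ratio limit 2, small enough that the coefficient
    \<open>r * (1 + e)\<close> of \<open>S\<close> stays below 1.\<close>
  define e where "e = (1 - r) / 2"
  have e: "0 < e" "r * (1 + e) < 1"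
  proof -
    show "0 < e" using r by (simp add: e_def)
    have "r * e \<le> 1 * e" using r by (intro mult_right_mono) (auto simp: e_def)
    moreover have "r + e < 1" using r by (simp add: e_def field_simps)
    ultimately show "r * (1 + e) < 1" by (simp add: distrib_left)
  qed
  have "\<forall>\<^sub>F v in at_top. (\<integral>y. T (v - y) \<partial>N) / T v < 2 + e"
    using order_tendstoD(2)[OF convolution_ratio] e by simp
  then obtain v1 where v1: "\<And>v. v1 \<le> v \<Longrightarrow> (\<integral>y. T (v - y) \<partial>N) / T v < 2 + e"
    by (auto simp: eventually_at_top_linorder)
  define w where "w = max v0 v1"
  define D where "D = max (1 / T w) (1 / (1 - r * (1 + e)))"
  have bound: "G t \<le> D * T t" for t
  proof (cases "t \<le> w")
    case True
    have "G t \<le> 1" by (rule G_le_1)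
    also have "1 \<le> (1 / T w) * T t" using T_antimono[OF True] by (simp add: T_pos)
    also have "\<dots> \<le> D * T t" by (intro mult_right_mono) (auto simp: D_def T_nonneg)
    finally show ?thesis .
  next
    case False
    define S where "S = (SUP u\<in>{..t}. G u / T u)"
    have bdd: "bdd_above ((\<lambda>u. G u / T u) ` {..t})"
    proof (rule bdd_aboveI2)
      fix u assume "u \<in> {..t}"
      then show "G u / T u \<le> 1 / T t"
        using G_le_1 G_nonneg T_antimono[of u t] by (intro frac_le) (auto simp: T_pos)
    qed
    have GS: "G u \<le> S * T u" if "u \<le> t" for u
      using cSUP_upper[of u "{..t}" "\<lambda>u. G u / T u", OF _ bdd] that T_pos[of u]
      by (simp add: S_def divide_le_eq)
    have S0: "0 \<le> S"
      using GS[of t] G_nonneg[of t] T_pos[of t] by (metis order.trans order_refl zero_le_mult_iff not_le)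
    have main: "G u / T u \<le> r * (1 + (1 + e) * S)" if u: "w \<le> u" "u \<le> t" for u
    proof -
      \<comment> \<open>For \<open>y > u\<close> the estimate \<open>S * T (u - y) = S\<close> is
        replaced by 1. This lowers the coefficient of \<open>S\<close> from \<open>2 + e\<close> to
        \<open>1 + e\<close>; \<open>r * (2 + e)\<close> could exceed 1.\<close>
      have "(\<integral>y. G (u - y) \<partial>N) \<le> (\<integral>y. S * T (u - y) + (1 - S) * indicator {u<..} y \<partial>N)"
      proof (rule integral_mono_AE)
        show "integrable N (\<lambda>y. G (u - y))"
          by (rule integrable_bounded[of _ 1]) (auto simp: G_nonneg G_le_1)
        show "integrable N (\<lambda>y. S * T (u - y) + (1 - S) * indicator {u<..} y)"
          by (intro Bochner_Integration.integrable_add integrable_mult_right integrable_T_shift)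
            (auto intro: integrable_bounded[of _ 1])
        show "AE y in N. G (u - y) \<le> S * T (u - y) + (1 - S) * indicator {u<..} y"
          using AE_N_nonneg
        proof eventually_elim
          case (elim y)
          then show ?case
            using u GS[of "u - y"] G_le_1[of "u - y"] T_neg[of "u - y"] by (cases "u < y") auto
        qed
      qed
      also have "\<dots> = S * (\<integral>y. T (u - y) \<partial>N) + (1 - S) * T u"
        by (subst Bochner_Integration.integral_add)
          (auto intro!: integrable_T_shift integrable_mult_right integrable_bounded[of "indicator {u<..}" 1]
            simp: measure_N_greaterThan)
      also have "\<dots> \<le> S * ((2 + e) * T u) + (1 - S) * T u"
        using v1[of u] u S0 T_pos[of u] by (intro add_right_mono mult_left_mono) (auto simp: w_def divide_less_eq)
      also have "\<dots> = (1 + (1 + e) * S) * T u" by (simp add: algebra_simps)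
      finally have "r * (\<integral>y. G (u - y) \<partial>N) \<le> r * ((1 + (1 + e) * S) * T u)"
        using r by (intro mult_left_mono)
      with ineq[of u] u have "G u \<le> r * (1 + (1 + e) * S) * T u"
        by (simp add: w_def mult.assoc)
      then show ?thesis using T_pos[of u] by (simp add: divide_le_eq)
    qed
    have "S \<le> max (1 / T w) (r * (1 + (1 + e) * S))"
      unfolding S_def
    proof (rule cSUP_least)
      fix u assume "u \<in> {..t}"
      show "G u / T u \<le> max (1 / T w) (r * (1 + (1 + e) * (SUP u\<in>{..t}. G u / T u)))"
      proof (cases "w \<le> u")
        case True
        then show ?thesis using main[of u] \<open>u \<in> {..t}\<close> by (auto simp: S_def[symmetric])
      next
        case False
        then have "G u / T u \<le> 1 / T w"
          using G_le_1 G_nonneg T_antimono[of u w] by (intro frac_le) (auto simp: T_pos)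
        then show ?thesis by simp
      qed
    qed simp
    moreover have "S \<le> 1 / (1 - r * (1 + e))" if "S \<le> r * (1 + (1 + e) * S)"
    proof -
      from that have "S * (1 - r * (1 + e)) \<le> r" by (simp add: algebra_simps)
      with r e have "S * (1 - r * (1 + e)) \<le> 1" by simp
      then show ?thesis using e by (simp add: pos_le_divide_eq)
    qed
    ultimately have "S \<le> D" by (auto simp: D_def max_def split: if_splits)
    then have "S * T t \<le> D * T t" by (intro mult_right_mono T_nonneg)
    then show ?thesis using GS[of t] by simp
  qed
  have "1 \<le> 1 / T w" by (simp add: T_pos T_le_1)
  then have "1 \<le> D" by (simp add: D_def)
  then show thesis using bound by (rule that)
qed

text \<open>The two halves of the limit 2 play different roles. Values \<open>y > v\<close> have
  mass \<open>T v\<close> and \<open>G\<close> is at most 1 there; the other values contribute about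
  \<open>a * T v\<close>. The strip \<open>v - K < y \<le> v\<close>, where the bound by
  \<open>a\<close> is not yet available, has mass \<open>T (v - K) - T v\<close>, which is
  negligible by long-tailedness.\<close>

lemma renewal_inequality_contraction:
  fixes G :: "real \<Rightarrow> real"
  assumes G_mono: "\<And>x y. x \<le> y \<Longrightarrow> G y \<le> G x"
    and G_nonneg: "\<And>x. 0 \<le> G x" and G_le_1: "\<And>x. G x \<le> 1"
    and r: "0 \<le> r" "r < 1"
    and ineq: "\<And>v. v0 \<le> v \<Longrightarrow> G v \<le> r * (\<integral>y. G (v - y) \<partial>N)"
    and a: "0 \<le> a" "\<forall>\<^sub>F u in at_top. G u \<le> a * T u"
    and \<epsilon>: "0 < \<epsilon>"
  shows "\<forall>\<^sub>F u in at_top. G u \<le> (r * (1 + a) + \<epsilon>) * T u"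
proof -
  have [measurable]: "G \<in> borel_measurable borel"
    using G_mono by (rule borel_measurable_antimono)
  obtain K0 where K0: "\<And>u. K0 \<le> u \<Longrightarrow> G u \<le> a * T u"
    using a(2) by (auto simp: eventually_at_top_linorder)
  define K where "K = max K0 0"
  have K: "0 \<le> K" "\<And>u. K \<le> u \<Longrightarrow> G u \<le> a * T u"
    using K0 by (auto simp: K_def)
  let ?R = "\<lambda>v. a * ((\<integral>y. T (v - y) \<partial>N) / T v) + (1 - a) + (T (v - K) / T v - 1)"
  have "(?R \<longlongrightarrow> a * 2 + (1 - a) + (1 - 1)) at_top"
    by (intro tendsto_intros convolution_ratio long_tailed K)
  then have "((\<lambda>v. r * ?R v) \<longlongrightarrow> r * (1 + a)) at_top"
    by (intro tendsto_mult_left) (simp add: algebra_simps)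
  then have "\<forall>\<^sub>F v in at_top. r * ?R v < r * (1 + a) + \<epsilon>"
    using order_tendstoD(2) \<epsilon> by fastforce
  then show ?thesis
    using eventually_ge_at_top[of v0] eventually_ge_at_top[of K]
  proof eventually_elim
    case (elim v)
    let ?b = "\<lambda>y. a * T (v - y) + ((1 - a) * indicator {v<..} y + indicator {v - K<..v} y)"
    have int: "integrable N (indicator A :: real \<Rightarrow> real)" if "A \<in> sets borel" for A
      using that by (intro integrable_bounded[of _ 1]) (auto simp: indicator_def)
    have "(\<integral>y. G (v - y) \<partial>N) \<le> (\<integral>y. ?b y \<partial>N)"
    proof (rule integral_mono_AE)
      show "integrable N (\<lambda>y. G (v - y))"
        by (rule integrable_bounded[of _ 1]) (auto simp: G_nonneg G_le_1)
      show "integrable N ?b"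
        by (intro Bochner_Integration.integrable_add integrable_mult_right integrable_T_shift int) auto
      show "AE y in N. G (v - y) \<le> ?b y"
        using AE_N_nonneg
      proof eventually_elim
        case (elim y)
        consider "v < y" | "v - K < y" "y \<le> v" | "y \<le> v - K" by linarith
        then show ?case
        proof cases
          case 1
          then show ?thesis using G_le_1[of "v - y"] T_neg[of "v - y"] by auto
        next
          case 2
          then show ?thesis using G_le_1[of "v - y"] a(1) T_nonneg[of "v - y"]
            by (auto simp: add_increasing)
        next
          case 3
          then show ?thesis using K(2)[of "v - y"] K(1) by auto
        qed
      qed
    qed
    also have "\<dots> = a * (\<integral>y. T (v - y) \<partial>N) + ((1 - a) * T v + (T (v - K) - T v))"
      using K(1) measure_N_Ioc[of "v - K" v]
      by (subst Bochner_Integration.integral_add;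
            (intro Bochner_Integration.integrable_add integrable_mult_right integrable_T_shift int)?)
          (simp_all add: int measure_N_greaterThan)
    also have "\<dots> = ?R v * T v"
      using T_pos[of v] by (simp add: distrib_right left_diff_distrib)
    finally have "r * (\<integral>y. G (v - y) \<partial>N) \<le> r * (?R v * T v)"
      using r by (intro mult_left_mono)
    also have "\<dots> \<le> (r * (1 + a) + \<epsilon>) * T v"
      using elim(1) unfolding mult.assoc[symmetric] by (intro mult_right_mono T_nonneg) simp
    finally show ?case using ineq[of v] elim by simp
  qed
qed

text \<open>The infimum \<open>s\<close> of all eventual constants cannot be improved by the
  contraction, so \<open>s \<le> r * (1 + s)\<close>. The crude bound makes the set of constants
  nonempty, hence \<open>s\<close> a genuine real number that can be solved for.\<close>

lemma renewal_inequality_asymp: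
  fixes G :: "real \<Rightarrow> real"
  assumes G_mono: "\<And>x y. x \<le> y \<Longrightarrow> G y \<le> G x"
    and G_nonneg: "\<And>x. 0 \<le> G x" and G_le_1: "\<And>x. G x \<le> 1"
    and r: "0 \<le> r" "r < 1"
    and ineq: "\<And>v. v0 \<le> v \<Longrightarrow> G v \<le> r * (\<integral>y. G (v - y) \<partial>N)"
    and b: "r / (1 - r) < b"
  shows "\<forall>\<^sub>F u in at_top. G u \<le> b * T u"
proof -
  define A where "A = {a. 0 \<le> a \<and> (\<forall>\<^sub>F u in at_top. G u \<le> a * T u)}"
  define s where "s = Inf A"
  obtain D where "1 \<le> D" "\<And>u. G u \<le> D * T u"
    using renewal_inequality_bounded[OF assms(1-6)] by blast
  then have "D \<in> A" by (simp add: A_def)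
  have bdd: "bdd_below A" by (auto simp: A_def intro!: bdd_belowI[of _ 0])
  have near: "\<exists>a\<in>A. a < s + e" if "0 < e" for e
    using cInf_lessD[of A "s + e"] \<open>D \<in> A\<close> that by (auto simp: s_def)
  have "s \<le> r * (1 + s)"
  proof (rule field_le_epsilon)
    fix e :: real assume e: "0 < e"
    obtain a where a: "a \<in> A" "a < s + e / 2" using near[of "e / 2"] e by auto
    then have "r * (1 + a) + e / 2 \<in> A"
      using renewal_inequality_contraction[OF assms(1-6), where a = a and \<epsilon> = "e / 2"] e r
      by (simp add: A_def)
    then have "s \<le> r * (1 + a) + e / 2" unfolding s_def by (rule cInf_lower[OF _ bdd])
    also have "\<dots> \<le> r * (1 + s) + 1 * (e / 2) + e / 2"
    proof -
      have "r * (1 + a) \<le> r * (1 + (s + e / 2))" using a r by (intro mult_left_mono) auto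
      also have "\<dots> = r * (1 + s) + r * (e / 2)" by (simp add: algebra_simps)
      also have "\<dots> \<le> r * (1 + s) + 1 * (e / 2)" using r e by (intro add_left_mono mult_right_mono) auto
      finally show ?thesis by simp
    qed
    finally show "s \<le> r * (1 + s) + e" by simp
  qed
  then have "s * (1 - r) \<le> r" by (simp add: algebra_simps)
  then have "s \<le> r / (1 - r)" using r by (simp add: pos_le_divide_eq)
  then obtain a where a: "a \<in> A" "a < b" using near[of "b - s"] b by auto
  then have "\<forall>\<^sub>F u in at_top. G u \<le> a * T u" by (simp add: A_def)
  then show ?thesis
  proof eventually_elim
    case (elim u)
    also have "a * T u \<le> b * T u" using a by (intro mult_right_mono T_nonneg) simp
    finally show ?case .
  qed
qed

end

section \<open>Random walks with negative drift\<close>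

text \<open>
  Integrating the one-step inequality \<open>H x \<le> \<integral> H (x + c - y) dB(y)\<close> over \<open>x\<close> makes the left-hand
  sides telescope and turns the claim size distribution into its integrated tail; no ladder
  heights are needed.
\<close>

lemma integrated_one_step_inequality:
  fixes H :: "real \<Rightarrow> real"
  assumes "real_distribution B" and B_nonneg: "AE y in B. 0 \<le> y"
    and H_mono: "\<And>x y. x \<le> y \<Longrightarrow> H y \<le> H x"
    and H_nonneg: "\<And>x. 0 \<le> H x" and H_le_1: "\<And>x. H x \<le> 1"
    and H_at_top: "(H \<longlongrightarrow> 0) at_top"
    and c: "0 < c"
    and one_step: "\<And>u. 0 \<le> u \<Longrightarrow> H u \<le> (\<integral>y. H (u + c - y) \<partial>B)"
    and v: "c \<le> v"
  shows "ennreal (c * H v) \<le>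
    (\<integral>\<^sup>+z. ennreal (H (v - z)) * (ennreal (measure B {z<..}) * indicator {0..} z) \<partial>lborel)"
proof -
  interpret B: real_distribution B by fact
  interpret pair_sigma_finite B lborel ..
  have [measurable]: "H \<in> borel_measurable borel"
    using H_mono by (rule borel_measurable_antimono)
  define I where "I a b = (\<integral>\<^sup>+x. ennreal (H x) * indicator {a<..b} x \<partial>lborel)" for a b
  have I_add: "I a b + I b d = I a d" if "a \<le> b" "b \<le> d" for a b d
    using that unfolding I_def
    by (subst nn_integral_add[symmetric]) (auto intro!: nn_integral_cong simp: indicator_def)
  have I_upper: "I a b \<le> ennreal ((b - a) * H a)" if "a \<le> b" for a b
  proof -
    have "I a b \<le> (\<integral>\<^sup>+x. ennreal (H a) * indicator {a<..b} x \<partial>lborel)"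
      unfolding I_def by (intro nn_integral_mono) (auto simp: indicator_def intro!: ennreal_leI H_mono)
    also have "\<dots> = ennreal ((b - a) * H a)"
      using that H_nonneg by (simp add: nn_integral_cmult ennreal_mult mult.commute)
    finally show ?thesis .
  qed
  have I_lower: "ennreal ((b - a) * H b) \<le> I a b" if "a \<le> b" for a b
  proof -
    have "ennreal ((b - a) * H b) = (\<integral>\<^sup>+x. ennreal (H b) * indicator {a<..b} x \<partial>lborel)"
      using that H_nonneg by (simp add: nn_integral_cmult ennreal_mult mult.commute)
    also have "\<dots> \<le> I a b"
      unfolding I_def by (intro nn_integral_mono) (auto simp: indicator_def intro!: ennreal_leI H_mono)
    finally show ?thesis .
  qed
  have I_finite: "I a b \<noteq> \<infinity>" for a b
  proof (cases "a \<le> b")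
    case True
    then show ?thesis using I_upper[OF True] by (auto simp: top_unique)
  qed (simp add: I_def)
  have I_shift: "I (a - y) (b - y) = (\<integral>\<^sup>+x. ennreal (H (x - y)) * indicator {a<..b} x \<partial>lborel)" for a b y
    unfolding I_def by (subst nn_integral_real_affine[of _ 1 "- y"])
      (auto intro!: nn_integral_cong simp: indicator_def)
  define J where "J = (\<integral>\<^sup>+y. I (v - y) v \<partial>B)"
  \<comment> \<open>The cutoff \<open>R\<close> keeps all integrals finite, so that
    \<open>I v R\<close> can be cancelled on both sides. What remains is a strip of width
    \<open>c\<close> at \<open>v\<close> against \<open>J\<close> plus a strip of width
    \<open>c\<close> at \<open>R\<close>, and the latter disappears as \<open>R\<close>
    grows.\<close>
  have main: "ennreal (c * H v) \<le> J + ennreal (c * H (R - c))" if R: "v \<le> R" for R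
  proof -
    have "I (v - c) (R - c) = (\<integral>\<^sup>+x. ennreal (H (x - c)) * indicator {v<..R} x \<partial>lborel)"
      by (rule I_shift)
    also have "\<dots> \<le> (\<integral>\<^sup>+x. (\<integral>\<^sup>+y. ennreal (H (x - y)) * indicator {v<..R} x \<partial>B) \<partial>lborel)"
    proof (rule nn_integral_mono)
      fix x :: real
      show "ennreal (H (x - c)) * indicator {v<..R} x
          \<le> (\<integral>\<^sup>+y. ennreal (H (x - y)) * indicator {v<..R} x \<partial>B)"
      proof (cases "x \<in> {v<..R}")
        case True
        have "ennreal (H (x - c)) \<le> ennreal (\<integral>y. H (x - y) \<partial>B)"
          using one_step[of "x - c"] True v by (intro ennreal_leI) simp
        also have "\<dots> = (\<integral>\<^sup>+y. ennreal (H (x - y)) \<partial>B)"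
          by (rule nn_integral_eq_integral[symmetric])
            (auto intro!: B.integrable_const_bound[of _ 1] simp: H_nonneg H_le_1)
        finally show ?thesis using True by simp
      qed simp
    qed
    also have "\<dots> = (\<integral>\<^sup>+y. (\<integral>\<^sup>+x. ennreal (H (x - y)) * indicator {v<..R} x \<partial>lborel) \<partial>B)"
      by (rule Fubini') measurable
    also have "\<dots> = (\<integral>\<^sup>+y. I (v - y) (R - y) \<partial>B)"
      by (simp add: I_shift)
    also have "\<dots> \<le> (\<integral>\<^sup>+y. I (v - y) v + I v R \<partial>B)"
    proof (rule nn_integral_mono_AE)
      show "AE y in B. I (v - y) (R - y) \<le> I (v - y) v + I v R"
        using B_nonneg
      proof eventually_elim
        case (elim y)
        have "I (v - y) (R - y) \<le> I (v - y) (R - y) + I (R - y) R" by simp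
        also have "\<dots> = I (v - y) v + I v R" using elim R by (simp add: I_add)
        finally show ?case .
      qed
    qed
    also have "\<dots> = J + I v R"
    proof -
      have "(\<lambda>y. I (v - y) v) \<in> borel_measurable B"
      proof -
        have "(\<lambda>y. \<integral>\<^sup>+x. ennreal (H x) * (if v - y < x \<and> x \<le> v then 1 else 0) \<partial>lborel) \<in> borel_measurable B"
          by measurable
        then show ?thesis by (simp add: I_def indicator_def)
      qed
      then show ?thesis by (simp add: J_def nn_integral_add B.emeasure_space_1[simplified])
    qed
    finally have *: "I (v - c) (R - c) \<le> J + I v R" .
    have "I v R + I (v - c) v = I (v - c) (R - c) + I (R - c) R"
      using c R I_add[of "v - c" v R] I_add[of "v - c" "R - c" R] by (simp add: add.commute)
    also have "\<dots> \<le> (J + I v R) + I (R - c) R" using * by (rule add_right_mono)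
    also have "\<dots> = I v R + (J + I (R - c) R)" by (simp add: ac_simps)
    finally have "I (v - c) v \<le> J + I (R - c) R"
      using I_finite by (simp add: ennreal_add_left_cancel_le)
    moreover have "ennreal (c * H v) \<le> I (v - c) v" using I_lower[of "v - c" v] c by simp
    moreover have "I (R - c) R \<le> ennreal (c * H (R - c))" using I_upper[of "R - c" R] c by simp
    ultimately show ?thesis by (meson add_left_mono order.trans)
  qed
  have lim: "((\<lambda>R. J + ennreal (c * H (R - c))) \<longlongrightarrow> J + ennreal (c * 0)) at_top"
  proof -
    have "((\<lambda>R. H (R - c)) \<longlongrightarrow> 0) at_top"
    proof (rule filterlim_compose[OF H_at_top])
      show "filterlim (\<lambda>R. R - c) at_top at_top"
        unfolding filterlim_at_top eventually_at_top_linorder by (metis le_diff_eq)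
    qed
    then show ?thesis by (intro tendsto_add tendsto_const tendsto_ennrealI tendsto_mult)
  qed
  have "ennreal (c * H v) \<le> J + ennreal (c * 0)"
    by (rule tendsto_lowerbound[OF lim])
      (auto intro!: main eventually_mono[OF eventually_ge_at_top[of v]])
  also have "J + ennreal (c * 0) = J" by simp
  \<comment> \<open>Reflecting \<open>x\<close> to \<open>z = v - x\<close> turns
    \<open>{v - y<..v}\<close> into \<open>{0..<y}\<close>; exchanging the integrals then leaves the
    mass of \<open>B\<close> above \<open>z\<close>, which is the density of the integrated tail up
    to normalisation.\<close>
  also have "J = (\<integral>\<^sup>+y. (\<integral>\<^sup>+z. ennreal (H (v - z)) * indicator {0..<y} z \<partial>lborel) \<partial>B)"
    unfolding J_def I_def
    by (rule nn_integral_cong, subst nn_integral_real_affine[of _ "-1" v])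
      (auto intro!: nn_integral_cong simp: indicator_def)
  also have "\<dots> = (\<integral>\<^sup>+z. (\<integral>\<^sup>+y. ennreal (H (v - z)) * indicator {0..<y} z \<partial>B) \<partial>lborel)"
  proof (rule Fubini'[symmetric])
    have "(\<lambda>(y, z). ennreal (H (v - z)) * (if 0 \<le> z \<and> z < y then 1 else 0))
        \<in> borel_measurable (B \<Otimes>\<^sub>M lborel)"
      by measurable
    then show "(\<lambda>(y, z). ennreal (H (v - z)) * indicator {0..<y} z) \<in> borel_measurable (B \<Otimes>\<^sub>M lborel)"
      by (simp add: indicator_def)
  qed
  also have "\<dots> = (\<integral>\<^sup>+z. ennreal (H (v - z)) * (ennreal (measure B {z<..}) * indicator {0..} z) \<partial>lborel)"
  proof (rule nn_integral_cong)
    fix z :: real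
    have "(\<integral>\<^sup>+y. ennreal (H (v - z)) * indicator {0..<y} z \<partial>B)
        = (\<integral>\<^sup>+y. (ennreal (H (v - z)) * indicator {0..} z) * indicator {z<..} y \<partial>B)"
      by (rule nn_integral_cong) (auto simp: indicator_def)
    also have "\<dots> = (ennreal (H (v - z)) * indicator {0..} z) * emeasure B {z<..}"
      by (rule nn_integral_cmult_indicator) simp
    finally show "(\<integral>\<^sup>+y. ennreal (H (v - z)) * indicator {0..<y} z \<partial>B)
        = ennreal (H (v - z)) * (ennreal (measure B {z<..}) * indicator {0..} z)"
      by (simp add: B.emeasure_eq_measure ac_simps)
  qed
  finally show ?thesis .
qed

section \<open>Tails of finite-horizon maxima\<close>

text \<open>The probability that the maximum over at most \<open>n\<close> steps exceeds
  \<open>u\<close>, conditioned on the first step. The starting value 0 belongs to the maximum,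
  hence the value 1 for negative \<open>u\<close>.\<close>

primrec walk_tail :: "real measure \<Rightarrow> real \<Rightarrow> nat \<Rightarrow> real \<Rightarrow> real" where
  "walk_tail B c 0 u = (if u < 0 then 1 else 0)"
| "walk_tail B c (Suc n) u = (if u < 0 then 1 else \<integral>y. walk_tail B c n (u + c - y) \<partial>B)"

lemma walk_tail_bounds:
  assumes "real_distribution B"
  shows "0 \<le> walk_tail B c n u \<and> walk_tail B c n u \<le> 1 \<and>
    (\<forall>x y. x \<le> y \<longrightarrow> walk_tail B c n y \<le> walk_tail B c n x)"
proof -
  interpret B: real_distribution B by fact
  have "(\<forall>u. 0 \<le> walk_tail B c n u \<and> walk_tail B c n u \<le> 1) \<and>
    (\<forall>x y. x \<le> y \<longrightarrow> walk_tail B c n y \<le> walk_tail B c n x)"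
  proof (induction n)
    case (Suc n)
    then have [measurable]: "walk_tail B c n \<in> borel_measurable borel"
      by (intro borel_measurable_antimono) auto
    have int: "integrable B (\<lambda>y. walk_tail B c n (u + c - y))" for u
      by (rule B.integrable_const_bound[of _ 1]) (use Suc in auto)
    have bd: "0 \<le> walk_tail B c (Suc n) u \<and> walk_tail B c (Suc n) u \<le> 1" for u
      using Suc integral_mono[OF int[of u], of "\<lambda>_. 1"]
      by (auto intro!: integral_nonneg_AE simp: B.prob_space[simplified])
    have "walk_tail B c (Suc n) y \<le> walk_tail B c (Suc n) x" if "x \<le> y" for x y
    proof (cases "x < 0")
      case True then show ?thesis using bd[of y] by simp
    next
      case False
      then show ?thesis using that Suc by (auto intro!: integral_mono int)
    qed
    with bd show ?case by blast
  qed auto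
  then show ?thesis by blast
qed

lemma borel_measurable_walk_tail:
  "real_distribution B \<Longrightarrow> walk_tail B c n \<in> borel_measurable borel"
  by (rule borel_measurable_antimono) (simp add: walk_tail_bounds)

lemma walk_tail_neg: "u < 0 \<Longrightarrow> walk_tail B c n u = 1"
  by (cases n) auto

text \<open>A longer horizon can only raise the maximum. Combined with the recursion at
  \<open>Suc n\<close>, this is the one-step inequality with the same function on both sides, as the
  integration argument requires.\<close>

lemma walk_tail_Suc_mono:
  assumes "real_distribution B"
  shows "walk_tail B c n u \<le> walk_tail B c (Suc n) u"
proof -
  interpret B: real_distribution B by fact
  note [measurable] = borel_measurable_walk_tail[OF assms]
  have int: "integrable B (\<lambda>y. walk_tail B c n (u + c - y))" for u n
    by (rule B.integrable_const_bound[of _ 1]) (use walk_tail_bounds[OF assms] in auto)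
  show ?thesis
  proof (induction n arbitrary: u)
    case 0
    show ?case using walk_tail_bounds[OF assms, of c "Suc 0" u] by (auto simp: walk_tail_neg simp del: walk_tail.simps(2))
  next
    case (Suc n)
    show ?case
    proof (cases "u < 0")
      case False
      have "(\<integral>y. walk_tail B c n (u + c - y) \<partial>B) \<le> (\<integral>y. walk_tail B c (Suc n) (u + c - y) \<partial>B)"
        by (rule integral_mono[OF int int Suc.IH])
      with False show ?thesis by simp
    qed (simp add: walk_tail_neg)
  qed
qed

lemma walk_tail_at_top:
  assumes "real_distribution B"
  shows "(walk_tail B c n \<longlongrightarrow> 0) at_top"
proof (induction n)
  case 0
  show ?case
    by (rule tendsto_eventually) (auto intro!: eventually_mono[OF eventually_ge_at_top[of 0]])
next
  case (Suc n)
  interpret B: real_distribution B by fact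
  note [measurable] = borel_measurable_walk_tail[OF assms]
  have "((\<lambda>u. \<integral>y. walk_tail B c n (u + c - y) \<partial>B) \<longlongrightarrow> (\<integral>y. 0 \<partial>B)) at_top"
  proof (rule integral_dominated_convergence_at_top[where w = "\<lambda>_. 1"])
    show "AE y in B. ((\<lambda>u. walk_tail B c n (u + c - y)) \<longlongrightarrow> 0) at_top"
    proof (rule AE_I2)
      fix y
      have "filterlim (\<lambda>u. u + (c - y)) at_top at_top"
        by (rule filterlim_tendsto_add_at_top[OF tendsto_const filterlim_ident, of "c - y", unfolded add.commute[of "c - y"]])
      from filterlim_compose[OF Suc this]
      show "((\<lambda>u. walk_tail B c n (u + c - y)) \<longlongrightarrow> 0) at_top" by (simp add: add_diff_eq)
    qed
  qed (auto simp: walk_tail_bounds[OF assms])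
  then have "((\<lambda>u. \<integral>y. walk_tail B c n (u + c - y) \<partial>B) \<longlongrightarrow> 0) at_top" by simp
  then show ?case
    by (rule Lim_transform_eventually)
      (auto intro!: eventually_mono[OF eventually_ge_at_top[of 0]])
qed

text \<open>The maximum of 0 and the sums of \<open>x i - c\<close> over the first
  \<open>k \<le> n\<close> indices after \<open>j\<close>. Peeling off the first term instead of the
  last leaves a maximum of the same kind over later indices, independent of the peeled claim; the
  offset \<open>j\<close> keeps the family closed under peeling.\<close>

primrec walk_max :: "real \<Rightarrow> (nat \<Rightarrow> real) \<Rightarrow> nat \<Rightarrow> nat \<Rightarrow> real" where
  "walk_max c x 0 j = 0"
| "walk_max c x (Suc n) j = max 0 (x (Suc j) - c + walk_max c x n (Suc j))"

lemma walk_max_cong: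
  "(\<And>i. j < i \<Longrightarrow> i \<le> j + n \<Longrightarrow> x i = y i) \<Longrightarrow> walk_max c x n j = walk_max c y n j"
proof (induction n arbitrary: j)
  case (Suc n)
  have "walk_max c x n (Suc j) = walk_max c y n (Suc j)" by (rule Suc.IH) (simp add: Suc.prems)
  then show ?case using Suc.prems[of "Suc j"] by simp
qed simp

lemma walk_max_less_iff:
  "u < walk_max c x n j \<longleftrightarrow> (\<exists>k\<le>n. u < (\<Sum>i=Suc j..j + k. x i) - real k * c)"
proof (induction n arbitrary: j u)
  case (Suc n)
  have split: "(\<Sum>i=Suc j..j + Suc k. x i) = x (Suc j) + (\<Sum>i=Suc (Suc j)..Suc j + k. x i)" for k
    using sum.atLeast_Suc_atMost[of "Suc j" "j + Suc k" x] by simp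
  have "u < walk_max c x (Suc n) j \<longleftrightarrow> u < 0 \<or> u - x (Suc j) + c < walk_max c x n (Suc j)"
    by auto
  also have "\<dots> \<longleftrightarrow> u < 0 \<or> (\<exists>k\<le>n. u - x (Suc j) + c < (\<Sum>i=Suc (Suc j)..Suc j + k. x i) - real k * c)"
    by (simp only: Suc.IH)
  also have "\<dots> \<longleftrightarrow> u < 0 \<or> (\<exists>k\<le>n. u < (\<Sum>i=Suc j..j + Suc k. x i) - real (Suc k) * c)"
    unfolding split by (simp add: algebra_simps)
  also have "\<dots> \<longleftrightarrow> (\<exists>k\<le>Suc n. u < (\<Sum>i=Suc j..j + k. x i) - real k * c)"
  proof
    assume "u < 0 \<or> (\<exists>k\<le>n. u < (\<Sum>i=Suc j..j + Suc k. x i) - real (Suc k) * c)"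
    then show "\<exists>k\<le>Suc n. u < (\<Sum>i=Suc j..j + k. x i) - real k * c"
    proof
      assume "u < 0" then show ?thesis by (intro exI[of _ 0]) simp
    qed (use Suc_le_mono in blast)
  next
    assume "\<exists>k\<le>Suc n. u < (\<Sum>i=Suc j..j + k. x i) - real k * c"
    then obtain k where k: "k \<le> Suc n" "u < (\<Sum>i=Suc j..j + k. x i) - real k * c" by blast
    then show "u < 0 \<or> (\<exists>k\<le>n. u < (\<Sum>i=Suc j..j + Suc k. x i) - real (Suc k) * c)"
      by (cases k) auto
  qed
  finally show ?case .
qed auto

lemma measurable_walk_max:
  "{Suc j..j + n} \<subseteq> A \<Longrightarrow> (\<lambda>x. walk_max c x n j) \<in> borel_measurable (Pi\<^sub>M A (\<lambda>_. borel))"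
proof (induction n arbitrary: j)
  case (Suc n)
  have [measurable]: "(\<lambda>x. walk_max c x n (Suc j)) \<in> borel_measurable (Pi\<^sub>M A (\<lambda>_. borel))"
    using Suc.prems by (intro Suc.IH) auto
  have [measurable]: "(\<lambda>x. x (Suc j)) \<in> borel_measurable (Pi\<^sub>M A (\<lambda>_. borel))"
    using Suc.prems by (intro measurable_component_singleton) auto
  show ?case by simp
qed simp

lemma (in prob_space) indep_var_sum_tail:
  fixes X Y :: "'a \<Rightarrow> real"
  assumes ind: "indep_var borel X borel Y"
  shows "prob {\<omega>\<in>space M. a < X \<omega> + Y \<omega>} = (\<integral>x. prob {\<omega>\<in>space M. a - x < Y \<omega>} \<partial>distr M borel X)"
proof -
  have [measurable]: "random_variable borel X" "random_variable borel Y"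
    using indep_var_rv1[OF ind] indep_var_rv2[OF ind] .
  interpret X: prob_space "distr M borel X" by (rule prob_space_distr) measurable
  interpret Y: prob_space "distr M borel Y" by (rule prob_space_distr) measurable
  interpret pair_sigma_finite "distr M borel X" "distr M borel Y" ..
  have eq: "distr M borel X \<Otimes>\<^sub>M distr M borel Y = distr M (borel \<Otimes>\<^sub>M borel) (\<lambda>\<omega>. (X \<omega>, Y \<omega>))"
    using ind by (simp add: indep_var_distribution_eq)
  let ?S = "{p :: real \<times> real. a < fst p + snd p}"
  have "{p \<in> space (borel \<Otimes>\<^sub>M borel). a < fst p + snd p} \<in> sets (borel \<Otimes>\<^sub>M borel)"
    by measurable
  then have S: "?S \<in> sets (borel \<Otimes>\<^sub>M borel)" by (simp add: space_pair_measure)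
  have Y: "{y. a - x < y} \<in> sets borel" for x :: real by measurable
  have "emeasure M {\<omega>\<in>space M. a < X \<omega> + Y \<omega>} = emeasure (distr M (borel \<Otimes>\<^sub>M borel) (\<lambda>\<omega>. (X \<omega>, Y \<omega>))) ?S"
    by (subst emeasure_distr) (use S in \<open>auto intro!: arg_cong[where f = "emeasure M"]\<close>)
  also have "\<dots> = (\<integral>\<^sup>+x. emeasure (distr M borel Y) (Pair x -` ?S) \<partial>distr M borel X)"
    unfolding eq[symmetric] by (rule Y.emeasure_pair_measure_alt) (use S in simp)
  also have "\<dots> = (\<integral>\<^sup>+x. ennreal (prob {\<omega>\<in>space M. a - x < Y \<omega>}) \<partial>distr M borel X)"
  proof (rule nn_integral_cong)
    fix x
    have "Pair x -` ?S = {y. a - x < y}" by auto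
    then show "emeasure (distr M borel Y) (Pair x -` ?S) = ennreal (prob {\<omega>\<in>space M. a - x < Y \<omega>})"
      using Y[of x] by (simp add: emeasure_distr emeasure_eq_measure vimage_def Int_def conj_commute)
  qed
  also have "\<dots> = ennreal (\<integral>x. prob {\<omega>\<in>space M. a - x < Y \<omega>} \<partial>distr M borel X)"
  proof (rule nn_integral_eq_integral)
    have "(\<lambda>x. - prob {\<omega>\<in>space M. a - x < Y \<omega>}) \<in> borel_measurable borel"
      by (rule borel_measurable_antimono) (auto intro!: finite_measure_mono)
    then show "integrable (distr M borel X) (\<lambda>x. prob {\<omega>\<in>space M. a - x < Y \<omega>})"
      by (intro X.integrable_const_bound[of _ 1]) (auto simp: borel_measurable_uminus_eq)
  qed simp
  finally show ?thesis by (simp add: emeasure_eq_measure integral_nonneg_AE)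
qed

section \<open>The walk of i.i.d. claims and its integrated tail\<close>

locale iid_claims = prob_space M for M :: "'a measure" +
  fixes C :: "nat \<Rightarrow> 'a \<Rightarrow> real"
  assumes C_rv [measurable]: "C i \<in> borel_measurable M"
    and C_indep: "indep_vars (\<lambda>_. borel) C {1..}"
    and C_ident: "i \<ge> 1 \<Longrightarrow> distr M borel (C i) = distr M borel (C 1)"
    and C_nonneg: "\<omega> \<in> space M \<Longrightarrow> C i \<omega> \<ge> 0"
    and C_int: "integrable M (C 1)"
begin

declare One_nat_def [simp del]

abbreviation B :: "real measure" where "B \<equiv> distr M borel (C 1)"
abbreviation m :: real where "m \<equiv> expectation (C 1)"

sublocale B: real_distribution B by simp

lemma B_nonneg: "AE y in B. 0 \<le> y"
  by (subst AE_distr_iff) (auto simp: C_nonneg)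

lemma B_greaterThan: "measure B {x<..} = tail (claim_cdf M C) x"
proof -
  have "{x<..} = space B - {..x}" by auto
  then have "measure B {x<..} = 1 - measure B {..x}"
    using B.prob_compl[of "{..x}"] by simp
  then show ?thesis
    by (simp add: tail_def claim_cdf_def measure_distr vimage_def Int_def conj_commute)
qed

lemma prob_claim_greater: "1 \<le> i \<Longrightarrow> prob {\<omega>\<in>space M. x < C i \<omega>} = measure B {x<..}"
  using C_ident[of i, symmetric] by (simp add: measure_distr vimage_def Int_def conj_commute)

lemma random_variable_walk_max: "(\<lambda>\<omega>. walk_max c (\<lambda>i. C i \<omega>) n j) \<in> borel_measurable M"
  by (induction n arbitrary: j) auto

text \<open>The offset is generalised because the future of the first step starts at
  \<open>Suc j\<close>; identical distribution makes the result the same for every offset.\<close>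

lemma prob_walk_max: "prob {\<omega>\<in>space M. u < walk_max c (\<lambda>i. C i \<omega>) n j} = walk_tail B c n u"
proof (induction n arbitrary: u j)
  case (Suc n)
  show ?case
  proof (cases "u < 0")
    case True
    then have "{\<omega>\<in>space M. u < walk_max c (\<lambda>i. C i \<omega>) (Suc n) j} = space M" by auto
    with True show ?thesis by (simp add: prob_space)
  next
    case False
    let ?V = "\<lambda>\<omega>. walk_max c (\<lambda>i. C i \<omega>) n (Suc j)"
    have "indep_var borel ((\<lambda>x. x (Suc j)) \<circ> (\<lambda>\<omega>. restrict (\<lambda>i. C i \<omega>) {Suc j}))
        borel ((\<lambda>x. walk_max c x n (Suc j)) \<circ> (\<lambda>\<omega>. restrict (\<lambda>i. C i \<omega>) {Suc (Suc j)..}))"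
      by (intro indep_var_compose[OF indep_var_restrict[OF C_indep]] measurable_walk_max
           measurable_component_singleton) auto
    also have "(\<lambda>x. x (Suc j)) \<circ> (\<lambda>\<omega>. restrict (\<lambda>i. C i \<omega>) {Suc j}) = C (Suc j)"
      by auto
    also have "(\<lambda>x. walk_max c x n (Suc j)) \<circ> (\<lambda>\<omega>. restrict (\<lambda>i. C i \<omega>) {Suc (Suc j)..}) = ?V"
      by (auto simp: fun_eq_iff intro!: walk_max_cong)
    finally have ind: "indep_var borel (C (Suc j)) borel ?V" .
    have "prob {\<omega>\<in>space M. u < walk_max c (\<lambda>i. C i \<omega>) (Suc n) j} = prob {\<omega>\<in>space M. u + c < C (Suc j) \<omega> + ?V \<omega>}"
      using False by (intro arg_cong[where f = prob]) (auto simp: max_def algebra_simps)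
    also have "\<dots> = (\<integral>x. walk_tail B c n (u + c - x) \<partial>distr M borel (C (Suc j)))"
      unfolding indep_var_sum_tail[OF ind] Suc.IH ..
    finally show ?thesis using False C_ident[of "Suc j"] by simp
  qed
qed (auto simp: prob_space)

end

locale subexponential_claims = iid_claims M C + subexponential_distribution "integrated_tail M C"
  for M :: "'a measure" and C
begin

lemma F_eq: "integrated_tail M C x = (1 / m) * (LINT y:{0..x}|lborel. measure B {y<..})"
  by (simp add: integrated_tail_def B_greaterThan)

text \<open>With mean 0 the factor \<open>1 / m\<close> is 0 and the integrated tail would vanish
  identically, so it could not be a distribution function.\<close>

lemma m_pos: "0 < m"
proof (rule ccontr)
  assume "\<not> 0 < m"
  moreover have "0 \<le> m" by (intro integral_nonneg_AE) (auto simp: C_nonneg)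
  ultimately have "m = 0" by simp
  then have "integrated_tail M C = (\<lambda>_. 0)" by (simp add: F_eq fun_eq_iff)
  then have "((\<lambda>_. 0) \<longlongrightarrow> (1::real)) (at_top :: real filter)" using F_at_top by simp
  then show False by (simp add: tendsto_const_iff)
qed

lemma borel_B_tail [measurable]: "(\<lambda>y. measure B {y<..}) \<in> borel_measurable borel"
proof (rule borel_measurable_antimono)
  fix x y :: real assume "x \<le> y"
  then show "measure B {y<..} \<le> measure B {x<..}" by (intro B.finite_measure_mono) auto
qed

lemma set_integrable_B_tail: "set_integrable lborel {a..b} (\<lambda>y. measure B {y<..})"
proof (rule set_integrable_bound[where f = "\<lambda>_. 1 :: real"])
  show "set_integrable lborel {a..b} (\<lambda>_. 1 :: real)"
    by (rule borel_integrable_atLeastAtMost') simp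
qed (auto simp: set_borel_measurable_def)

text \<open>Identifies the Lebesgue weight produced by the integrated one-step inequality with the
  measure for which the renewal inequalities are stated.\<close>

lemma N_eq_density:
  "N = density lborel (\<lambda>y. ennreal (measure B {y<..} / m) * indicator {0..} y)" (is "_ = ?D")
proof (rule cdf_unique')
  show "finite_borel_measure N" by (rule N.finite_borel_measure_M)
  have D: "emeasure ?D {..x} = ennreal (integrated_tail M C x)" for x
  proof -
    have "emeasure ?D {..x} = (\<integral>\<^sup>+y. ennreal (indicator {0..x} y * (measure B {y<..} / m)) \<partial>lborel)"
      by (subst emeasure_density) (auto intro!: nn_integral_cong simp: indicator_def)
    also have "\<dots> = ennreal (\<integral>y. indicator {0..x} y * (measure B {y<..} / m) \<partial>lborel)"
    proof (rule nn_integral_eq_integral)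
      show "integrable lborel (\<lambda>y. indicator {0..x} y * (measure B {y<..} / m))"
        using integrable_divide[OF set_integrable_B_tail[of 0 x, unfolded set_integrable_def], of m]
        by simp
    qed (use m_pos in \<open>auto simp: indicator_def\<close>)
    also have "\<dots> = ennreal (integrated_tail M C x)"
      using integral_mult_left_zero[of lborel "\<lambda>y. indicator {0..x} y * measure B {y<..}" "1 / m"]
      by (simp add: F_eq set_lebesgue_integral_def)
    finally show ?thesis .
  qed
  \<comment> \<open>Comparing distribution functions requires finite measures, and the density is
    not known in advance to have finite mass; the masses of \<open>{..real n}\<close> are at most 1
    and increase to the total.\<close>
  have "emeasure ?D UNIV = emeasure ?D (\<Union>n::nat. {..real n})"
    by (intro arg_cong[where f = "emeasure ?D"]) (auto simp: real_arch_simple)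
  also have "\<dots> = (SUP n. emeasure ?D {..real n})"
    by (rule SUP_emeasure_incseq[symmetric]) (auto simp: incseq_def)
  also have "\<dots> \<le> 1"
    unfolding D by (rule SUP_least) (use N.prob_le_1 in \<open>auto simp: measure_N_atMost[symmetric]\<close>)
  finally have "emeasure ?D UNIV \<le> 1" .
  then have "emeasure ?D UNIV \<noteq> \<infinity>" by (auto simp: top_unique)
  then interpret D: finite_measure ?D by (intro finite_measureI) simp
  show "finite_borel_measure ?D"
    by (simp add: finite_borel_measure_def finite_borel_measure_axioms_def D.finite_measure_axioms)
  show "cdf N = cdf ?D"
  proof
    fix x
    have "0 \<le> integrated_tail M C x" using measure_nonneg[of N "{..x}"] by (simp only: measure_N_atMost)
    then have "measure ?D {..x} = integrated_tail M C x"
      using measure_def[of ?D "{..x}"] by (simp only: D enn2real_ennreal)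
    then show "cdf N x = cdf ?D x" by (simp only: cdf_def2 measure_N_atMost)
  qed
qed

lemma walk_renewal_inequality:
  assumes c: "0 < c" "c \<le> v"
  shows "walk_tail B c n v \<le> m / c * (\<integral>y. walk_tail B c n (v - y) \<partial>N)"
proof -
  have rd: "real_distribution B" by simp
  note [measurable] = borel_measurable_walk_tail[OF rd]
  have one_step: "walk_tail B c n u \<le> (\<integral>y. walk_tail B c n (u + c - y) \<partial>B)" if "0 \<le> u" for u
    using walk_tail_Suc_mono[OF rd, of c n u] that by simp
  have "ennreal (c * walk_tail B c n v) \<le>
    (\<integral>\<^sup>+z. ennreal (walk_tail B c n (v - z)) * (ennreal (measure B {z<..}) * indicator {0..} z) \<partial>lborel)"
    using c one_step
    by (intro integrated_one_step_inequality[OF rd B_nonneg] walk_tail_at_top[OF rd])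
       (auto simp: walk_tail_bounds[OF rd])
  also have "\<dots> = (\<integral>\<^sup>+z. ennreal m * (ennreal (measure B {z<..} / m) * indicator {0..} z
      * ennreal (walk_tail B c n (v - z))) \<partial>lborel)"
    using m_pos by (intro nn_integral_cong)
      (auto simp: indicator_def ennreal_mult[symmetric] walk_tail_bounds[OF rd])
  also have "\<dots> = ennreal m * (\<integral>\<^sup>+z. ennreal (walk_tail B c n (v - z)) \<partial>N)"
    unfolding N_eq_density by (subst nn_integral_density) (auto simp: nn_integral_cmult)
  also have "\<dots> = ennreal m * ennreal (\<integral>z. walk_tail B c n (v - z) \<partial>N)"
    by (subst nn_integral_eq_integral)
      (auto intro!: integrable_bounded[of _ 1] simp: walk_tail_bounds[OF rd])
  also have "\<dots> = ennreal (m * (\<integral>z. walk_tail B c n (v - z) \<partial>N))"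
    using m_pos by (subst ennreal_mult) (auto intro!: integral_nonneg_AE simp: walk_tail_bounds[OF rd])
  finally have "c * walk_tail B c n v \<le> m * (\<integral>z. walk_tail B c n (v - z) \<partial>N)"
    using m_pos by (subst (asm) ennreal_le_iff)
      (auto intro!: mult_nonneg_nonneg integral_nonneg_AE simp: walk_tail_bounds[OF rd])
  then show ?thesis using c by (simp add: field_simps)
qed

text \<open>\<open>G\<close> is the supremum over the horizon. The renewal inequality survives this
  passage because its right-hand side is monotone in the function, and the renewal lemmas ask only
  for monotonicity and values in [0, 1].\<close>

lemma walk_max_tail_bound:
  assumes c: "m < c" and b: "(m / c) / (1 - m / c) < b"
  obtains G D where "\<And>n u. prob {\<omega>\<in>space M. u < walk_max c (\<lambda>i. C i \<omega>) n 0} \<le> G u"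
    "\<And>x y. x \<le> y \<Longrightarrow> G y \<le> G x" "1 \<le> D" "\<And>u. G u \<le> D * T u" "\<forall>\<^sub>F u in at_top. G u \<le> b * T u"
proof -
  have rd: "real_distribution B" by simp
  have c0: "0 < c" using m_pos c by simp
  define G where "G u = (SUP n. walk_tail B c n u)" for u
  have bdd: "bdd_above (range (\<lambda>n. walk_tail B c n u))" for u
    by (rule bdd_aboveI2[of _ _ 1]) (simp add: walk_tail_bounds[OF rd])
  have le_G: "walk_tail B c n u \<le> G u" for n u
    unfolding G_def by (rule cSUP_upper[OF _ bdd]) simp
  have G_mono: "G y \<le> G x" if "x \<le> y" for x y
    unfolding G_def by (rule cSUP_mono[OF _ bdd]) (use walk_tail_bounds[OF rd] that in blast)+
  have G_nonneg: "0 \<le> G u" for u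
    using le_G[of 0 u] walk_tail_bounds[OF rd, of c 0 u] by linarith
  have G_le_1: "G u \<le> 1" for u
    unfolding G_def by (rule cSUP_least) (auto simp: walk_tail_bounds[OF rd])
  note [measurable] = borel_measurable_walk_tail[OF rd] borel_measurable_antimono[OF G_mono]
  have ineq: "G v \<le> m / c * (\<integral>y. G (v - y) \<partial>N)" if "c \<le> v" for v
    unfolding G_def[of v]
  proof (rule cSUP_least)
    fix n
    have "walk_tail B c n v \<le> m / c * (\<integral>y. walk_tail B c n (v - y) \<partial>N)"
      by (rule walk_renewal_inequality[OF c0 that])
    also have "\<dots> \<le> m / c * (\<integral>y. G (v - y) \<partial>N)"
      using m_pos c0
      by (intro mult_left_mono integral_mono le_G integrable_bounded[of _ 1])
        (auto simp: walk_tail_bounds[OF rd] G_nonneg G_le_1)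
    finally show "walk_tail B c n v \<le> m / c * (\<integral>y. G (v - y) \<partial>N)" .
  qed simp
  have r: "0 \<le> m / c" "m / c < 1" using m_pos c c0 by auto
  obtain D where D: "1 \<le> D" "\<And>u. G u \<le> D * T u"
    using renewal_inequality_bounded[OF G_mono G_nonneg G_le_1 r ineq] by blast
  show thesis
    by (rule that[OF _ G_mono D renewal_inequality_asymp[OF G_mono G_nonneg G_le_1 r ineq b]])
      (simp_all add: prob_walk_max le_G)
qed

end

section \<open>Arrival times\<close>

locale ldp_arrivals = prob_space M for M :: "'a measure" +
  fixes \<tau> :: "nat \<Rightarrow> 'a \<Rightarrow> real" and I :: "real \<Rightarrow> ereal" and \<mu> :: real
  assumes tau_rv [measurable]: "\<tau> i \<in> borel_measurable M"
    and tau0: "\<omega> \<in> space M \<Longrightarrow> \<tau> 0 \<omega> = 0"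
    and tau_strict: "\<omega> \<in> space M \<Longrightarrow> \<tau> i \<omega> < \<tau> (Suc i) \<omega>"
    and tau_infty: "\<omega> \<in> space M \<Longrightarrow> filterlim (\<lambda>i. \<tau> i \<omega>) at_top sequentially"
    and ldp: "LDP M (\<lambda>t \<omega>. real (count_proc \<tau> t \<omega>) / t) I"
    and I_zero: "I x = 0 \<longleftrightarrow> x = \<mu>"
    and I_mono: "mono_on {\<mu>..} I"
    and I_antimono: "antimono_on {0..\<mu>} I"
begin

lemma tau_mono:
  assumes "\<omega> \<in> space M" "i \<le> j"
  shows "\<tau> i \<omega> \<le> \<tau> j \<omega>"
  using lift_Suc_mono_le[of "\<lambda>i. \<tau> i \<omega>", OF less_imp_le[OF tau_strict[OF assms(1)]] assms(2)] .

lemma tau_nonneg: "\<omega> \<in> space M \<Longrightarrow> 0 \<le> \<tau> i \<omega>"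
  using tau_mono[of \<omega> 0 i] tau0[of \<omega>] by simp

lemma tau_pos: "\<omega> \<in> space M \<Longrightarrow> 1 \<le> i \<Longrightarrow> 0 < \<tau> i \<omega>"
  using tau_mono[of \<omega> 1 i] tau_strict[of \<omega> 0] tau0[of \<omega>] by simp

lemma count_proc_ge_iff:
  assumes \<omega>: "\<omega> \<in> space M" and k: "1 \<le> k"
  shows "k \<le> count_proc \<tau> t \<omega> \<longleftrightarrow> \<tau> k \<omega> \<le> t"
proof
  \<comment> \<open>\<open>card\<close> is 0 on infinite sets, so the count would be meaningless
    without the divergence of the arrival times.\<close>
  have fin: "finite {i. 1 \<le> i \<and> \<tau> i \<omega> \<le> t}"
  proof -
    obtain n where n: "\<And>i. n \<le> i \<Longrightarrow> t + 1 \<le> \<tau> i \<omega>"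
      using tau_infty[OF \<omega>] unfolding filterlim_at_top eventually_sequentially by blast
    have "{i. 1 \<le> i \<and> \<tau> i \<omega> \<le> t} \<subseteq> {..<n}"
    proof
      fix i assume "i \<in> {i. 1 \<le> i \<and> \<tau> i \<omega> \<le> t}"
      then show "i \<in> {..<n}" using n[of i] by (auto simp: not_less[symmetric])
    qed
    then show ?thesis by (rule finite_subset) simp
  qed
  assume "\<tau> k \<omega> \<le> t"
  then have "{1..k} \<subseteq> {i. 1 \<le> i \<and> \<tau> i \<omega> \<le> t}"
    using tau_mono[OF \<omega>, of _ k] by force
  from card_mono[OF fin this] show "k \<le> count_proc \<tau> t \<omega>"
    by (simp add: count_proc_def)
next
  assume le: "k \<le> count_proc \<tau> t \<omega>"
  show "\<tau> k \<omega> \<le> t"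
  proof (rule ccontr)
    assume "\<not> \<tau> k \<omega> \<le> t"
    then have "{i. 1 \<le> i \<and> \<tau> i \<omega> \<le> t} \<subseteq> {1..<k}"
      using tau_mono[OF \<omega>, of k] by (force simp: not_less[symmetric])
    from card_mono[OF _ this] have "count_proc \<tau> t \<omega> \<le> k - 1"
      by (simp add: count_proc_def)
    with le k show False by simp
  qed
qed

lemma measurable_count_proc [measurable]: "count_proc \<tau> t \<in> measurable M (count_space UNIV)"
proof -
  have ge: "{\<omega>\<in>space M. k \<le> count_proc \<tau> t \<omega>} \<in> sets M" for k
  proof (cases "1 \<le> k")
    case True
    then have "{\<omega>\<in>space M. k \<le> count_proc \<tau> t \<omega>} = {\<omega>\<in>space M. \<tau> k \<omega> \<le> t}"
      using count_proc_ge_iff by auto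
    then show ?thesis by simp
  qed simp
  have "count_proc \<tau> t -` {k} \<inter> space M \<in> sets M" for k
  proof -
    have "count_proc \<tau> t -` {k} \<inter> space M =
        {\<omega>\<in>space M. k \<le> count_proc \<tau> t \<omega>} - {\<omega>\<in>space M. Suc k \<le> count_proc \<tau> t \<omega>}"
      by auto
    then show ?thesis using ge by auto
  qed
  then show ?thesis by (subst measurable_count_space_eq2_countable) auto
qed

lemma I_nonneg: "0 \<le> I x"
  using ldp by (simp add: LDP_def rate_function_def)

text \<open>If \<mu> were negative, the open half-line below 0 would contain the zero of
  \<open>I\<close>, so the lower bound of the large deviation principle would be 0 there. But
  \<open>N_t / t\<close> is never negative, and the logarithm of probability 0 is
  -\<infinity>.\<close>

lemma mu_nonneg: "0 \<le> \<mu>"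
proof (rule ccontr)
  assume "\<not> 0 \<le> \<mu>"
  then have "(INF x\<in>{..<0}. I x) \<le> 0"
    using I_zero[of \<mu>] by (intro INF_lower2[of \<mu>]) auto
  then have "0 \<le> - (INF x\<in>{..<0}. I x)" by (simp add: ereal_0_le_uminus_iff)
  also have "\<dots> \<le> Liminf at_top (\<lambda>t. ereal (1 / t) * elog (prob {\<omega>\<in>space M. real (count_proc \<tau> t \<omega>) / t \<in> {..<0}}))"
    by (rule ldp[unfolded LDP_def, THEN conjunct2, THEN conjunct2, THEN spec, THEN mp]) simp
  also have "\<dots> = Liminf at_top (\<lambda>t::real. -\<infinity>)"
  proof (rule Liminf_eq, use eventually_gt_at_top[of 0] in eventually_elim)
    case (elim t)
    then have "{\<omega>\<in>space M. real (count_proc \<tau> t \<omega>) / t \<in> {..<0}} = {}"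
      by (auto simp: divide_less_0_iff)
    then show ?case using elim by (simp only: measure_empty) (simp add: elog_def)
  qed
  also have "\<dots> = (-\<infinity> :: ereal)" by (simp add: Liminf_const)
  finally show False by simp
qed

lemma ldp_exponential_bound:
  assumes "closed F" "0 < (INF x\<in>F. I x)"
  obtains \<kappa> where "0 < \<kappa>"
    "\<forall>\<^sub>F t in at_top. prob {\<omega>\<in>space M. real (count_proc \<tau> t \<omega>) / t \<in> F} \<le> exp (- \<kappa> * t)"
proof -
  let ?P = "\<lambda>t. prob {\<omega>\<in>space M. real (count_proc \<tau> t \<omega>) / t \<in> F}"
  obtain \<kappa> where \<kappa>: "0 < ereal \<kappa>" "ereal \<kappa> < (INF x\<in>F. I x)"
    using ereal_dense2[OF assms(2)] by blast
  have "Limsup at_top (\<lambda>t. ereal (1 / t) * elog (?P t)) \<le> - (INF x\<in>F. I x)"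
    using ldp assms(1) unfolding LDP_def by blast
  also have "\<dots> < - ereal \<kappa>" using \<kappa>(2) by (simp only: ereal_minus_less_minus)
  finally have "\<forall>\<^sub>F t in at_top. ereal (1 / t) * elog (?P t) < - ereal \<kappa>"
    by (rule Limsup_lessD)
  then have "\<forall>\<^sub>F t in at_top. ?P t \<le> exp (- \<kappa> * t)"
    using eventually_gt_at_top[of 0]
  proof eventually_elim
    case (elim t)
    show ?case
    \<comment> \<open>\<open>elog\<close> is -\<infinity> at 0, where the bound is trivial;
      elsewhere it is an ordinary logarithm.\<close>
    proof (cases "?P t \<le> 0")
      case True
      then show ?thesis by (rule order.trans) simp
    next
      case False
      then have "ln (?P t) / t < - \<kappa>" using elim(1) by (simp add: elog_def)
      then have "ln (?P t) < - \<kappa> * t" using elim(2) by (simp add: divide_less_eq)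
      then have "exp (ln (?P t)) < exp (- \<kappa> * t)" by (simp only: exp_less_cancel_iff)
      then show ?thesis using False by simp
    qed
  qed
  with \<kappa>(1) show thesis by (intro that) auto
qed

text \<open>At time \<open>t = k / a\<close> the event \<tau> k \<le> t says that
  \<open>N_t / t \<ge> a\<close>, and on \<open>{a..}\<close> the rate function is at least
  \<open>I a > 0\<close>.\<close>

lemma early_arrival_bound:
  assumes a: "\<mu> < a"
  obtains K \<kappa> where "0 < K" "0 < \<kappa>" "\<And>k. 1 \<le> k \<Longrightarrow> prob {\<omega>\<in>space M. \<tau> k \<omega> \<le> real k / a} \<le> K * exp (- \<kappa> * real k)"
proof -
  have a0: "0 < a" using a mu_nonneg by simp
  have "0 < I a" using I_nonneg[of a] I_zero[of a] a by (auto simp: less_le)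
  also have "I a \<le> (INF x\<in>{a..}. I x)"
    using a by (intro INF_greatest mono_onD[OF I_mono]) auto
  finally obtain \<kappa> where \<kappa>: "0 < \<kappa>"
    "\<forall>\<^sub>F t in at_top. prob {\<omega>\<in>space M. real (count_proc \<tau> t \<omega>) / t \<in> {a..}} \<le> exp (- \<kappa> * t)"
    using ldp_exponential_bound[of "{a..}"] by auto
  then obtain t1 where t1: "\<And>t. t1 \<le> t \<Longrightarrow>
      prob {\<omega>\<in>space M. real (count_proc \<tau> t \<omega>) / t \<in> {a..}} \<le> exp (- \<kappa> * t)"
    unfolding eventually_at_top_linorder by blast
  show thesis
  \<comment> \<open>The large deviation bound starts only at \<open>t1\<close>; for smaller
    \<open>t\<close> this constant makes the claimed bound at least 1. The rate becomes
    \<open>\<kappa> / a\<close> because \<open>t = k / a\<close>.\<close>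
  proof (rule that[of "exp (\<kappa> * max t1 0)" "\<kappa> / a"])
    fix k :: nat assume k: "1 \<le> k"
    define t where "t = real k / a"
    have t: "0 < t" "a * t = real k" using k a0 by (auto simp: t_def)
    have eq: "{\<omega>\<in>space M. real (count_proc \<tau> t \<omega>) / t \<in> {a..}} = {\<omega>\<in>space M. \<tau> k \<omega> \<le> t}"
      using t count_proc_ge_iff[OF _ k, of _ t] by (auto simp: pos_le_divide_eq)
    have "prob {\<omega>\<in>space M. \<tau> k \<omega> \<le> t} \<le> exp (\<kappa> * max t1 0) * exp (- \<kappa> * t)"
    proof (cases "t1 \<le> t")
      case True
      have "prob {\<omega>\<in>space M. \<tau> k \<omega> \<le> t} \<le> 1 * exp (- \<kappa> * t)" using t1[OF True] unfolding eq by simp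
      also have "\<dots> \<le> exp (\<kappa> * max t1 0) * exp (- \<kappa> * t)" using \<kappa> by (intro mult_right_mono) auto
      finally show ?thesis .
    next
      case False
      then have "\<kappa> * t \<le> \<kappa> * max t1 0" using \<kappa> by (intro mult_left_mono) auto
      then have "1 \<le> exp (\<kappa> * max t1 0) * exp (- \<kappa> * t)" by (simp add: exp_add[symmetric])
      then show ?thesis using prob_le_1 order.trans by blast
    qed
    then show "prob {\<omega>\<in>space M. \<tau> k \<omega> \<le> real k / a} \<le> exp (\<kappa> * max t1 0) * exp (- (\<kappa> / a) * real k)"
      by (simp add: t_def)
  qed (use \<kappa> a0 in auto)
qed

text \<open>If \<tau> k exceeds \<open>t = k / a\<close>, fewer than \<open>k\<close> arrivals have
  occurred by \<open>t\<close>, so \<open>N_t / t\<close> lies in \<open>{0..a}\<close>, where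
  \<open>I\<close> is at least \<open>I a > 0\<close>.\<close>

lemma late_arrival_tendsto:
  assumes a: "0 < a" "a < \<mu>"
  shows "(\<lambda>k. prob {\<omega>\<in>space M. real k / a < \<tau> k \<omega>}) \<longlonglongrightarrow> 0"
proof -
  have "0 < I a" using I_nonneg[of a] I_zero[of a] a by (auto simp: less_le)
  also have "I a \<le> (INF x\<in>{0..a}. I x)"
    using a by (intro INF_greatest monotone_onD[OF I_antimono, simplified]) auto
  finally obtain \<kappa> where \<kappa>: "0 < \<kappa>"
    "\<forall>\<^sub>F t in at_top. prob {\<omega>\<in>space M. real (count_proc \<tau> t \<omega>) / t \<in> {0..a}} \<le> exp (- \<kappa> * t)"
    using ldp_exponential_bound[of "{0..a}"] by auto
  have lim: "filterlim (\<lambda>k. real k / a) at_top sequentially"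
    using filterlim_tendsto_pos_mult_at_top[OF tendsto_const[of "1 / a"] _ filterlim_real_sequentially] a
    by simp
  show ?thesis
  proof (rule tendsto_sandwich[of "\<lambda>_. 0"])
    show "\<forall>\<^sub>F k in sequentially. prob {\<omega>\<in>space M. real k / a < \<tau> k \<omega>} \<le> exp (- \<kappa> * (real k / a))"
      using eventually_compose_filterlim[OF \<kappa>(2) lim] eventually_ge_at_top[of 1]
    proof eventually_elim
      case (elim k)
      define t where "t = real k / a"
      have t: "0 < t" "a * t = real k" using elim a by (auto simp: t_def)
      have "{\<omega>\<in>space M. t < \<tau> k \<omega>} \<subseteq> {\<omega>\<in>space M. real (count_proc \<tau> t \<omega>) / t \<in> {0..a}}"
      proof
        fix \<omega> assume \<omega>: "\<omega> \<in> {\<omega>\<in>space M. t < \<tau> k \<omega>}"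
        then have "count_proc \<tau> t \<omega> < k"
          using count_proc_ge_iff[of \<omega> k t] elim by auto
        then show "\<omega> \<in> {\<omega>\<in>space M. real (count_proc \<tau> t \<omega>) / t \<in> {0..a}}"
          using \<omega> t by (simp add: pos_divide_le_eq)
      qed
      then have "prob {\<omega>\<in>space M. t < \<tau> k \<omega>} \<le> prob {\<omega>\<in>space M. real (count_proc \<tau> t \<omega>) / t \<in> {0..a}}"
        by (rule finite_measure_mono) measurable
      with elim(1) show ?case by (simp add: t_def)
    qed
    have "filterlim (\<lambda>k. - \<kappa> * (real k / a)) at_bot sequentially"
      using \<kappa>(1) by (intro filterlim_tendsto_neg_mult_at_bot[OF tendsto_const _ lim]) simp
    then show "(\<lambda>k. exp (- \<kappa> * (real k / a))) \<longlonglongrightarrow> 0"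
      by (rule filterlim_compose[OF exp_at_bot])
  qed auto
qed

text \<open>An excess of \<open>y\<close> needs \<open>k \<ge> y / c\<close>, since premiums are
  nonnegative, and it makes the \<open>k\<close>-th arrival early. The union bound is then a
  geometric series starting near \<open>y / c\<close>, which gives decay in \<open>y\<close>
  uniformly in \<open>n\<close>.\<close>

lemma arrival_excess_bound:
  assumes p: "0 < p" and c: "0 < c" "\<mu> < p / c"
  obtains K \<kappa> where "0 < K" "0 < \<kappa>"
    "\<And>n y. 0 \<le> y \<Longrightarrow> prob {\<omega>\<in>space M. \<exists>k\<in>{1..n}. y \<le> real k * c - p * \<tau> k \<omega>} \<le> K * exp (- \<kappa> * y)"
proof -
  obtain K \<kappa> where K: "0 < K" "0 < \<kappa>"
    "\<And>k. 1 \<le> k \<Longrightarrow> prob {\<omega>\<in>space M. \<tau> k \<omega> \<le> real k / (p / c)} \<le> K * exp (- \<kappa> * real k)"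
    using early_arrival_bound[OF c(2)] by blast
  define q where "q = exp (- \<kappa>)"
  have q: "0 < q" "q < 1" using K by (auto simp: q_def)
  have q_power: "exp (- \<kappa> * real k) = q ^ k" for k
    using exp_of_nat_mult[of k "- \<kappa>"] by (simp add: q_def mult.commute)
  show thesis
  proof (rule that[of "K / (1 - q)" "\<kappa> / c"])
    fix n :: nat and y :: real assume y: "0 \<le> y"
    define k0 where "k0 = nat \<lceil>y / c\<rceil>"
    have k0: "y / c \<le> real k0" by (simp add: k0_def real_nat_ceiling_ge)
    let ?S = "{k\<in>{1..n}. k0 \<le> k}"
    have "{\<omega>\<in>space M. \<exists>k\<in>{1..n}. y \<le> real k * c - p * \<tau> k \<omega>}
        \<subseteq> (\<Union>k\<in>?S. {\<omega>\<in>space M. \<tau> k \<omega> \<le> real k / (p / c)})"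
    proof
      fix \<omega> assume "\<omega> \<in> {\<omega>\<in>space M. \<exists>k\<in>{1..n}. y \<le> real k * c - p * \<tau> k \<omega>}"
      then obtain k where k: "\<omega> \<in> space M" "k \<in> {1..n}" "y \<le> real k * c - p * \<tau> k \<omega>" by blast
      have "0 \<le> p * \<tau> k \<omega>" using p tau_nonneg[OF k(1)] by simp
      then have "y / c \<le> real k" using k(3) c by (simp add: pos_divide_le_eq)
      then have "k0 \<le> k" by (simp add: k0_def nat_le_iff ceiling_le_iff)
      moreover have "\<tau> k \<omega> \<le> real k / (p / c)"
        using k(3) y p by (simp add: pos_le_divide_eq mult.commute)
      ultimately show "\<omega> \<in> (\<Union>k\<in>?S. {\<omega>\<in>space M. \<tau> k \<omega> \<le> real k / (p / c)})"
        using k by blast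
    qed
    then have "prob {\<omega>\<in>space M. \<exists>k\<in>{1..n}. y \<le> real k * c - p * \<tau> k \<omega>}
        \<le> prob (\<Union>k\<in>?S. {\<omega>\<in>space M. \<tau> k \<omega> \<le> real k / (p / c)})"
      by (rule finite_measure_mono) measurable
    also have "\<dots> \<le> (\<Sum>k\<in>?S. prob {\<omega>\<in>space M. \<tau> k \<omega> \<le> real k / (p / c)})"
      by (rule finite_measure_subadditive_finite) auto
    also have "\<dots> \<le> (\<Sum>k\<in>?S. K * q ^ k)"
    proof (rule sum_mono)
      fix k assume "k \<in> ?S"
      then show "prob {\<omega>\<in>space M. \<tau> k \<omega> \<le> real k / (p / c)} \<le> K * q ^ k"
        using K(3)[of k] unfolding q_power by simp
    qed
    also have "\<dots> \<le> (\<Sum>k\<in>{k0..k0 + n}. K * q ^ k)"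
      using K q by (intro sum_mono2) auto
    also have "\<dots> = K * q ^ k0 * (\<Sum>k\<le>n. q ^ k)"
      using sum.shift_bounds_cl_nat_ivl[of "\<lambda>k. K * q ^ k" 0 k0 n]
      by (simp add: atMost_atLeast0 power_add sum_distrib_left add.commute mult_ac)
    also have "\<dots> \<le> K * exp (- (\<kappa> / c) * y) * (1 / (1 - q))"
    proof (intro mult_mono)
      have "(\<Sum>k\<le>n. q ^ k) \<le> (\<Sum>k. q ^ k)"
        using q by (intro sum_le_suminf summable_geometric) auto
      then show "(\<Sum>k\<le>n. q ^ k) \<le> 1 / (1 - q)"
        using q by (simp add: suminf_geometric)
      have "\<kappa> * (y / c) \<le> \<kappa> * real k0" using K k0 by (intro mult_left_mono) auto
      then show "q ^ k0 \<le> exp (- (\<kappa> / c) * y)" unfolding q_power[symmetric] by simp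
    qed (use K q in \<open>auto intro!: sum_nonneg\<close>)
    finally show "prob {\<omega>\<in>space M. \<exists>k\<in>{1..n}. y \<le> real k * c - p * \<tau> k \<omega>}
        \<le> K / (1 - q) * exp (- (\<kappa> / c) * y)"
      by (simp add: mult.commute)
  qed (use K q c in auto)
qed

end

section \<open>Ruin probabilities\<close>

locale risk_model = subexponential_claims M C + ldp_arrivals M \<tau> I \<mu>
  for M :: "'a measure" and C \<tau> :: "nat \<Rightarrow> 'a \<Rightarrow> real" and I :: "real \<Rightarrow> ereal" and \<mu> :: real +
  fixes p :: real
  assumes p_pos: "0 < p"
    and indep_C_N: "indep_var (Pi\<^sub>M {1..} (\<lambda>_. borel)) (\<lambda>\<omega>. \<lambda>i\<in>{1..}. C i \<omega>)
        (Pi\<^sub>M UNIV (\<lambda>_. borel)) (\<lambda>\<omega> i. \<tau> i \<omega>)"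
begin

text \<open>Independence is given for the claim sequence restricted to positive indices;
  \<open>P_cong\<close> expresses that the predicate does not look at index 0.\<close>

lemma prob_claims_arrivals:
  assumes P: "Measurable.pred (Pi\<^sub>M {1..} (\<lambda>_. borel)) P"
    and Q: "Measurable.pred (Pi\<^sub>M UNIV (\<lambda>_. borel)) Q"
    and P_cong: "\<And>\<omega>. P (\<lambda>i\<in>{1..}. C i \<omega>) \<longleftrightarrow> P (\<lambda>i. C i \<omega>)"
  shows "prob {\<omega>\<in>space M. P (\<lambda>i. C i \<omega>) \<and> Q (\<lambda>i. \<tau> i \<omega>)}
    = prob {\<omega>\<in>space M. P (\<lambda>i. C i \<omega>)} * prob {\<omega>\<in>space M. Q (\<lambda>i. \<tau> i \<omega>)}"
proof -
  let ?X = "{x\<in>space (Pi\<^sub>M {1..} (\<lambda>_. borel :: real measure)). P x}"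
  let ?Y = "{x\<in>space (Pi\<^sub>M UNIV (\<lambda>_. borel :: real measure)). Q x}"
  let ?c = "\<lambda>\<omega>. \<lambda>i\<in>{1..}. C i \<omega>" and ?t = "\<lambda>\<omega> i. \<tau> i \<omega>"
  have "prob ((\<lambda>\<omega>. (?c \<omega>, ?t \<omega>)) -` (?X \<times> ?Y) \<inter> space M)
      = prob (?c -` ?X \<inter> space M) * prob (?t -` ?Y \<inter> space M)"
    using P Q by (intro indep_varD[OF indep_C_N]) (auto simp: pred_def)
  moreover have "(\<lambda>\<omega>. (?c \<omega>, ?t \<omega>)) -` (?X \<times> ?Y) \<inter> space M
      = {\<omega>\<in>space M. P (\<lambda>i. C i \<omega>) \<and> Q (\<lambda>i. \<tau> i \<omega>)}"
    using P_cong by (auto simp: space_PiM)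
  moreover have "?c -` ?X \<inter> space M = {\<omega>\<in>space M. P (\<lambda>i. C i \<omega>)}"
    using P_cong by (auto simp: space_PiM)
  moreover have "?t -` ?Y \<inter> space M = {\<omega>\<in>space M. Q (\<lambda>i. \<tau> i \<omega>)}"
    by (auto simp: space_PiM)
  ultimately show ?thesis by simp
qed

text \<open>The surplus only grows between arrivals, so it is lowest right after a claim. Strictly
  increasing arrival times make the count at \<tau> k exactly \<open>k\<close>, and before the first
  claim the surplus is positive.\<close>

lemma ruin_iff:
  assumes \<omega>: "\<omega> \<in> space M" and u: "0 < u"
  shows "ruin_time u p C \<tau> \<omega> < \<infinity> \<longleftrightarrow> (\<exists>k\<ge>1. u \<le> (\<Sum>i=1..k. C i \<omega>) - p * \<tau> k \<omega>)"
proof -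
  have "ruin_time u p C \<tau> \<omega> < \<infinity> \<longleftrightarrow> (\<exists>t>0. surplus u p C \<tau> t \<omega> \<le> 0)"
    unfolding ruin_time_def Inf_less_iff by auto
  also have "\<dots> \<longleftrightarrow> (\<exists>k\<ge>1. u \<le> (\<Sum>i=1..k. C i \<omega>) - p * \<tau> k \<omega>)"
  proof
    assume "\<exists>t>0. surplus u p C \<tau> t \<omega> \<le> 0"
    then obtain t where t: "0 < t" "surplus u p C \<tau> t \<omega> \<le> 0" by blast
    define k where "k = count_proc \<tau> t \<omega>"
    have le: "u + p * t \<le> (\<Sum>i=1..k. C i \<omega>)"
      using t(2) by (simp add: surplus_def k_def)
    have "0 < u + p * t" using u p_pos t by (simp add: add_pos_pos)
    with le have k: "1 \<le> k" by (cases k) auto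
    then have "\<tau> k \<omega> \<le> t" using count_proc_ge_iff[OF \<omega> k, of t] by (simp add: k_def)
    then have "p * \<tau> k \<omega> \<le> p * t" using p_pos by simp
    with le have "u \<le> (\<Sum>i=1..k. C i \<omega>) - p * \<tau> k \<omega>" by simp
    with k show "\<exists>k\<ge>1. u \<le> (\<Sum>i=1..k. C i \<omega>) - p * \<tau> k \<omega>" by blast
  next
    assume "\<exists>k\<ge>1. u \<le> (\<Sum>i=1..k. C i \<omega>) - p * \<tau> k \<omega>"
    then obtain k where k: "1 \<le> k" "u \<le> (\<Sum>i=1..k. C i \<omega>) - p * \<tau> k \<omega>" by blast
    have "k \<le> count_proc \<tau> (\<tau> k \<omega>) \<omega>" using count_proc_ge_iff[OF \<omega> k(1)] by simp
    moreover have "\<not> Suc k \<le> count_proc \<tau> (\<tau> k \<omega>) \<omega>"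
      using count_proc_ge_iff[OF \<omega>, of "Suc k"] tau_strict[OF \<omega>, of k] by simp
    ultimately have "count_proc \<tau> (\<tau> k \<omega>) \<omega> = k" by simp
    then have "surplus u p C \<tau> (\<tau> k \<omega>) \<omega> \<le> 0" using k(2) by (simp add: surplus_def)
    then show "\<exists>t>0. surplus u p C \<tau> t \<omega> \<le> 0" using tau_pos[OF \<omega> k(1)] by blast
  qed
  finally show ?thesis .
qed

lemma ruin_prob_eq:
  "0 < u \<Longrightarrow> ruin_prob M u p C \<tau> = prob {\<omega>\<in>space M. \<exists>k\<ge>1. u \<le> (\<Sum>i=1..k. C i \<omega>) - p * \<tau> k \<omega>}"
  unfolding ruin_prob_def using ruin_iff by (intro arg_cong[where f = prob]) auto

text \<open>Ruin within the first \<open>n\<close> claims increases to ruin, so finite-horizon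
  estimates uniform in \<open>n\<close> suffice.\<close>

lemma ruin_prob_finite_horizon:
  assumes u: "0 < u"
    and le: "\<And>n. prob {\<omega>\<in>space M. \<exists>k\<in>{1..n}. u \<le> (\<Sum>i=1..k. C i \<omega>) - p * \<tau> k \<omega>} \<le> x"
  shows "ruin_prob M u p C \<tau> \<le> x"
proof -
  let ?R = "\<lambda>n. {\<omega>\<in>space M. \<exists>k\<in>{1..n}. u \<le> (\<Sum>i=1..k. C i \<omega>) - p * \<tau> k \<omega>}"
  have "(\<lambda>n. prob (?R n)) \<longlonglongrightarrow> prob (\<Union>n. ?R n)"
    by (rule finite_Lim_measure_incseq) (fastforce simp: incseq_def)+
  then have "prob (\<Union>n. ?R n) \<le> x"
    by (rule tendsto_upperbound) (auto simp: le)
  also have "(\<Union>n. ?R n) = {\<omega>\<in>space M. \<exists>k\<ge>1. u \<le> (\<Sum>i=1..k. C i \<omega>) - p * \<tau> k \<omega>}"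
    by (auto; metis atLeastAtMost_iff order_refl)
  finally show ?thesis using u by (simp add: ruin_prob_eq)
qed

text \<open>
  Splitting \<open>S k - p * \<tau> k\<close> as \<open>(S k - k * c) + (k * c - p * \<tau> k)\<close> separates the claims from the
  arrivals; the second summand has a light-tailed maximum.
\<close>

lemma ruin_prob_upper_split:
  assumes c: "m < c" "\<mu> < p / c"
    and G: "\<And>n u. prob {\<omega>\<in>space M. u < walk_max c (\<lambda>i. C i \<omega>) n 0} \<le> G u"
    and D: "\<And>u. G u \<le> D * T u" "1 \<le> D"
  obtains W \<eta> where "0 < W" "0 < \<eta>"
    "\<And>A u. 0 < u \<Longrightarrow> ruin_prob M u p C \<tau> \<le> G (u - real (Suc A)) + W * exp (- \<eta> * real A) * T u"
proof -
  have c0: "0 < c" using m_pos c by simp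
  obtain K \<kappa> where K: "0 < K" "0 < \<kappa>"
    "\<And>n y. 0 \<le> y \<Longrightarrow> prob {\<omega>\<in>space M. \<exists>k\<in>{1..n}. y \<le> real k * c - p * \<tau> k \<omega>} \<le> K * exp (- \<kappa> * y)"
    using arrival_excess_bound[OF p_pos c0 c(2)] by blast
  \<comment> \<open>Half of the exponential rate pays for lowering the level by \<open>j\<close>,
    and the other half keeps the sum over \<open>j\<close> geometric.\<close>
  define \<eta> where "\<eta> = \<kappa> / 2"
  have \<eta>: "0 < \<eta>" using K by (simp add: \<eta>_def)
  obtain A0 where A0: "0 < A0" "\<And>u j. 0 \<le> u \<Longrightarrow> T (u - real j) \<le> A0 * exp (\<eta> * real j) * T u"
    using exponential_lower_bound[OF \<eta>] by blast
  define q where "q = exp (- \<eta>)"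
  have q: "0 < q" "q < 1" using \<eta> by (auto simp: q_def)
  have q_power: "exp (- \<eta> * real j) = q ^ j" for j
    using exp_of_nat_mult[of j "- \<eta>"] by (simp add: q_def mult.commute)
  define W where "W = K * D * A0 * exp \<eta> / (1 - q)"
  show thesis
  proof (rule that[of W \<eta>])
    show "0 < W" using K D(2) A0 q by (simp add: W_def)
    fix A :: nat and u :: real assume u: "0 < u"
    show "ruin_prob M u p C \<tau> \<le> G (u - real (Suc A)) + W * exp (- \<eta> * real A) * T u"
    proof (rule ruin_prob_finite_horizon[OF u])
      fix n
      let ?V = "\<lambda>\<omega>. walk_max c (\<lambda>i. C i \<omega>) n 0"
      let ?Y = "\<lambda>j \<omega>. \<exists>k\<in>{1..n}. real j \<le> real k * c - p * \<tau> k \<omega>"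
      define J where "J = nat \<lceil>real n * c\<rceil>"
      have [measurable]: "?V \<in> borel_measurable M" by (rule random_variable_walk_max)
      \<comment> \<open>Slices by the integer part \<open>j\<close> of the excess
        \<open>k * c - p * \<tau> k\<close>. Below \<open>A\<close> the claims alone must nearly
        reach \<open>u\<close>; otherwise both a large walk and a large excess occur, and these are
        independent. The excess is at most \<open>n * c\<close>, so finitely many slices
        suffice.\<close>
      have "{\<omega>\<in>space M. \<exists>k\<in>{1..n}. u \<le> (\<Sum>i=1..k. C i \<omega>) - p * \<tau> k \<omega>}
          \<subseteq> {\<omega>\<in>space M. u - real (Suc A) < ?V \<omega>}
            \<union> (\<Union>j\<in>{A..A + J}. {\<omega>\<in>space M. u - real (Suc j) < ?V \<omega> \<and> ?Y j \<omega>})"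
      proof
        fix \<omega> assume "\<omega> \<in> {\<omega>\<in>space M. \<exists>k\<in>{1..n}. u \<le> (\<Sum>i=1..k. C i \<omega>) - p * \<tau> k \<omega>}"
        then obtain k where k: "\<omega> \<in> space M" "k \<in> {1..n}" "u \<le> (\<Sum>i=1..k. C i \<omega>) - p * \<tau> k \<omega>"
          by blast
        define y where "y = real k * c - p * \<tau> k \<omega>"
        have V: "v < ?V \<omega>" if "v < (\<Sum>i=1..k. C i \<omega>) - real k * c" for v
          unfolding walk_max_less_iff using k(2) that by (intro exI[of _ k]) (simp add: One_nat_def)
        have uy: "u - y \<le> (\<Sum>i=1..k. C i \<omega>) - real k * c" using k(3) by (simp add: y_def)
        show "\<omega> \<in> {\<omega>\<in>space M. u - real (Suc A) < ?V \<omega>}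
            \<union> (\<Union>j\<in>{A..A + J}. {\<omega>\<in>space M. u - real (Suc j) < ?V \<omega> \<and> ?Y j \<omega>})"
        proof (cases "y < real A")
          case True
          then show ?thesis using uy k(1) by (auto intro!: V)
        next
          case False
          define j where "j = nat \<lfloor>y\<rfloor>"
          have j: "real j \<le> y" "y < real j + 1" using False by (auto simp: j_def)
          have "y \<le> real n * c"
            using k(2) c0 p_pos tau_nonneg[OF k(1), of k]
            by (auto simp: y_def intro!: order.trans[OF _ mult_right_mono[of "real k" "real n" c]])
          then have "real j \<le> real J" using j(1) by (simp add: J_def) linarith
          moreover have "A \<le> j" using j(2) False by linarith
          moreover have "u - real (Suc j) < ?V \<omega>" using uy j(2) by (intro V) simp
          moreover have "?Y j \<omega>" using k(2) j(1) by (auto simp: y_def)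
          ultimately show ?thesis using k(1) by auto
        qed
      qed
      then have "prob {\<omega>\<in>space M. \<exists>k\<in>{1..n}. u \<le> (\<Sum>i=1..k. C i \<omega>) - p * \<tau> k \<omega>}
          \<le> prob ({\<omega>\<in>space M. u - real (Suc A) < ?V \<omega>}
            \<union> (\<Union>j\<in>{A..A + J}. {\<omega>\<in>space M. u - real (Suc j) < ?V \<omega> \<and> ?Y j \<omega>}))"
        by (rule finite_measure_mono) measurable
      also have "\<dots> \<le> prob {\<omega>\<in>space M. u - real (Suc A) < ?V \<omega>}
          + prob (\<Union>j\<in>{A..A + J}. {\<omega>\<in>space M. u - real (Suc j) < ?V \<omega> \<and> ?Y j \<omega>})"
        by (rule measure_Un_le) measurable
      also have "\<dots> \<le> G (u - real (Suc A))
          + (\<Sum>j\<in>{A..A + J}. prob {\<omega>\<in>space M. u - real (Suc j) < ?V \<omega> \<and> ?Y j \<omega>})"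
        by (intro add_mono G finite_measure_subadditive_finite image_subsetI) (simp, measurable)
      also have "(\<Sum>j\<in>{A..A + J}. prob {\<omega>\<in>space M. u - real (Suc j) < ?V \<omega> \<and> ?Y j \<omega>})
          \<le> (\<Sum>j\<in>{A..A + J}. (K * D * A0 * exp \<eta> * T u) * q ^ j)"
      proof (rule sum_mono)
        fix j
        have "prob {\<omega>\<in>space M. u - real (Suc j) < ?V \<omega> \<and> ?Y j \<omega>}
            = prob {\<omega>\<in>space M. u - real (Suc j) < ?V \<omega>} * prob {\<omega>\<in>space M. ?Y j \<omega>}"
        proof (rule prob_claims_arrivals)
          have [measurable]: "(\<lambda>x. walk_max c x n 0) \<in> borel_measurable (Pi\<^sub>M {1..} (\<lambda>_. borel))"
            by (rule measurable_walk_max) auto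
          show "Measurable.pred (Pi\<^sub>M {1..} (\<lambda>_. borel)) (\<lambda>x. u - real (Suc j) < walk_max c x n 0)"
            by measurable
          show "Measurable.pred (Pi\<^sub>M UNIV (\<lambda>_. borel)) (\<lambda>t. \<exists>k\<in>{1..n}. real j \<le> real k * c - p * t k)"
            by measurable
          have "walk_max c (\<lambda>i\<in>{1..}. C i \<omega>) n 0 = ?V \<omega>" for \<omega>
            by (rule walk_max_cong) auto
          then show "u - real (Suc j) < walk_max c (\<lambda>i\<in>{1..}. C i \<omega>) n 0 \<longleftrightarrow> u - real (Suc j) < ?V \<omega>" for \<omega>
            by simp
        qed
        also have "\<dots> \<le> (D * (A0 * exp (\<eta> * real (Suc j)) * T u)) * (K * exp (- \<kappa> * real j))"
        proof (rule mult_mono)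
          have "prob {\<omega>\<in>space M. u - real (Suc j) < ?V \<omega>} \<le> D * T (u - real (Suc j))"
            using G D(1) order.trans by blast
          also have "\<dots> \<le> D * (A0 * exp (\<eta> * real (Suc j)) * T u)"
            using A0(2)[of u "Suc j"] u D(2) by (intro mult_left_mono) auto
          finally show "prob {\<omega>\<in>space M. u - real (Suc j) < ?V \<omega>} \<le> D * (A0 * exp (\<eta> * real (Suc j)) * T u)" .
          show "0 \<le> D * (A0 * exp (\<eta> * real (Suc j)) * T u)"
            using D(2) A0(1) by (intro mult_nonneg_nonneg T_nonneg) auto
        qed (use K(3) in auto)
        also have "\<dots> = (K * D * A0 * T u) * (exp (\<eta> * real (Suc j)) * exp (- \<kappa> * real j))"
          by (simp only: mult_ac)
        also have "exp (\<eta> * real (Suc j)) * exp (- \<kappa> * real j) = exp \<eta> * q ^ j"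
          unfolding q_power[symmetric] exp_add[symmetric] by (simp add: \<eta>_def field_simps)
        finally show "prob {\<omega>\<in>space M. u - real (Suc j) < ?V \<omega> \<and> ?Y j \<omega>}
            \<le> (K * D * A0 * exp \<eta> * T u) * q ^ j"
          by (simp only: mult_ac)
      qed
      also have "\<dots> = (K * D * A0 * exp \<eta> * T u * q ^ A) * (\<Sum>j\<le>J. q ^ j)"
        using sum.shift_bounds_cl_nat_ivl[of "\<lambda>j. (K * D * A0 * exp \<eta> * T u) * q ^ j" 0 A J]
        by (simp add: atMost_atLeast0 power_add sum_distrib_left add.commute mult_ac)
      also have "\<dots> \<le> (K * D * A0 * exp \<eta> * T u * q ^ A) * (1 / (1 - q))"
      proof (rule mult_left_mono)
        have "(\<Sum>k\<le>J. q ^ k) \<le> (\<Sum>k. q ^ k)"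
          using q by (intro sum_le_suminf summable_geometric) auto
        then show "(\<Sum>k\<le>J. q ^ k) \<le> 1 / (1 - q)"
          using q by (simp add: suminf_geometric)
        show "0 \<le> K * D * A0 * exp \<eta> * T u * q ^ A"
          using K D(2) A0 q by (intro mult_nonneg_nonneg T_nonneg) auto
      qed
      also have "\<dots> = W * exp (- \<eta> * real A) * T u"
        unfolding q_power W_def by (simp add: mult_ac)
      finally show "prob {\<omega>\<in>space M. \<exists>k\<in>{1..n}. u \<le> (\<Sum>i=1..k. C i \<omega>) - p * \<tau> k \<omega>}
          \<le> G (u - real (Suc A)) + W * exp (- \<eta> * real A) * T u"
        by simp
    qed
  qed (rule \<eta>)
qed

lemma ruin_prob_upper_bound:
  assumes c: "m < c" "\<mu> < p / c" and b: "(m / c) / (1 - m / c) < b"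
  shows "\<forall>\<^sub>F u in at_top. ruin_prob M u p C \<tau> \<le> b * T u"
proof -
  have c0: "0 < c" using m_pos c by simp
  have "0 < (m / c) / (1 - m / c)" using m_pos c c0 by (intro divide_pos_pos) auto
  \<comment> \<open>Half of the gap \<open>b - b1\<close> will pay for the shift of the level by
    \<open>Suc A\<close>, the other half for the arrival error.\<close>
  define b1 where "b1 = ((m / c) / (1 - m / c) + b) / 2"
  have b1: "(m / c) / (1 - m / c) < b1" "b1 < b" using b by (auto simp: b1_def field_simps)
  with \<open>0 < (m / c) / (1 - m / c)\<close> have b1_pos: "0 < b1" by linarith
  obtain G D where G: "\<And>n u. prob {\<omega>\<in>space M. u < walk_max c (\<lambda>i. C i \<omega>) n 0} \<le> G u"
    "\<And>x y. x \<le> y \<Longrightarrow> G y \<le> G x" "1 \<le> D" "\<And>u. G u \<le> D * T u" "\<forall>\<^sub>F u in at_top. G u \<le> b1 * T u"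
    by (rule walk_max_tail_bound[OF c(1) b1(1)], rule that)
  obtain W \<eta> where W: "0 < W" "0 < \<eta>"
    "\<And>A u. 0 < u \<Longrightarrow> ruin_prob M u p C \<tau> \<le> G (u - real (Suc A)) + W * exp (- \<eta> * real A) * T u"
    using ruin_prob_upper_split[OF c G(1,4,3)] by blast
  have "(\<lambda>A. W * exp (- \<eta> * real A)) \<longlonglongrightarrow> W * 0"
  proof (intro tendsto_mult tendsto_const filterlim_compose[OF exp_at_bot])
    show "filterlim (\<lambda>A. - \<eta> * real A) at_bot sequentially"
      using W(2) by (intro filterlim_tendsto_neg_mult_at_bot[OF tendsto_const _ filterlim_real_sequentially]) simp
  qed
  then have "\<forall>\<^sub>F A in sequentially. W * exp (- \<eta> * real A) < (b - b1) / 2"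
    by (rule order_tendstoD) (use b1 in simp)
  then obtain A where A: "W * exp (- \<eta> * real A) < (b - b1) / 2"
    by (auto simp: eventually_sequentially)
  have "((\<lambda>u. b1 * (T (u - real (Suc A)) / T u)) \<longlongrightarrow> b1 * 1) at_top"
    by (intro tendsto_mult tendsto_const long_tailed) simp
  then have "\<forall>\<^sub>F u in at_top. b1 * (T (u - real (Suc A)) / T u) < b1 + (b - b1) / 2"
    by (rule order_tendstoD) (use b1 in simp)
  moreover have "\<forall>\<^sub>F u in at_top. G (u - real (Suc A)) \<le> b1 * T (u - real (Suc A))"
  proof (rule eventually_compose_filterlim[OF G(5)])
    show "filterlim (\<lambda>u. u - real (Suc A)) at_top at_top"
      unfolding filterlim_at_top eventually_at_top_linorder by (metis le_diff_eq)
  qed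
  ultimately show ?thesis
    using eventually_gt_at_top[of 0]
  proof eventually_elim
    case (elim u)
    have "b1 * T (u - real (Suc A)) = b1 * (T (u - real (Suc A)) / T u) * T u"
      using T_pos[of u] by simp
    also have "\<dots> \<le> (b1 + (b - b1) / 2) * T u"
      using elim(1) by (intro mult_right_mono T_nonneg) simp
    finally have "b1 * T (u - real (Suc A)) \<le> (b1 + (b - b1) / 2) * T u" .
    moreover have "W * exp (- \<eta> * real A) * T u \<le> (b - b1) / 2 * T u"
      using A by (intro mult_right_mono T_nonneg) simp
    ultimately have "ruin_prob M u p C \<tau> \<le> (b1 + (b - b1) / 2) * T u + (b - b1) / 2 * T u"
      using W(3)[OF elim(3), of A] elim(2) by linarith
    also have "\<dots> = b * T u" by (simp add: field_simps)
    finally show ?case .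
  qed
qed

end

section \<open>Claims before and at the big jump\<close>

context iid_claims begin

lemma prob_past_claim:
  assumes P: "Measurable.pred (Pi\<^sub>M {1..<k} (\<lambda>_. borel)) P"
    and P_cong: "\<And>\<omega>. P (\<lambda>i\<in>{1..<k}. C i \<omega>) \<longleftrightarrow> P (\<lambda>i. C i \<omega>)"
    and k: "1 \<le> k"
  shows "prob {\<omega>\<in>space M. P (\<lambda>i. C i \<omega>) \<and> t < C k \<omega>} =
    prob {\<omega>\<in>space M. P (\<lambda>i. C i \<omega>)} * prob {\<omega>\<in>space M. t < C k \<omega>}"
proof -
  let ?X = "{y\<in>space (Pi\<^sub>M {1..<k} (\<lambda>_. borel :: real measure)). P y}"
  let ?Y = "{y\<in>space (Pi\<^sub>M {k} (\<lambda>_. borel :: real measure)). t < y k}"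
  let ?r = "\<lambda>J \<omega>. \<lambda>i\<in>J. C i \<omega>"
  have Y: "?Y \<in> sets (Pi\<^sub>M {k} (\<lambda>_. borel))" by measurable
  have "prob ((\<lambda>\<omega>. (?r {1..<k} \<omega>, ?r {k} \<omega>)) -` (?X \<times> ?Y) \<inter> space M)
      = prob (?r {1..<k} -` ?X \<inter> space M) * prob (?r {k} -` ?Y \<inter> space M)"
    using k P Y by (intro indep_varD[OF indep_var_restrict[OF C_indep]]) (auto simp: pred_def)
  moreover have "(\<lambda>\<omega>. (?r {1..<k} \<omega>, ?r {k} \<omega>)) -` (?X \<times> ?Y) \<inter> space M
      = {\<omega>\<in>space M. P (\<lambda>i. C i \<omega>) \<and> t < C k \<omega>}"
    using P_cong by (auto simp: space_PiM)
  moreover have "?r {1..<k} -` ?X \<inter> space M = {\<omega>\<in>space M. P (\<lambda>i. C i \<omega>)}"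
    using P_cong by (auto simp: space_PiM)
  moreover have "?r {k} -` ?Y \<inter> space M = {\<omega>\<in>space M. t < C k \<omega>}"
    by (auto simp: space_PiM)
  ultimately show ?thesis by simp
qed

text \<open>Only a first moment is available, so claims are truncated at a level \<open>K\<close>
  whose truncated mean still exceeds \<open>x\<close>. Truncation can only decrease the sum, so
  Hoeffding's inequality for the bounded variables controls the lower deviation of the original
  sum.\<close>

lemma weak_law_lower:
  assumes x: "x < m"
  shows "(\<lambda>n. prob {\<omega>\<in>space M. (\<Sum>i=1..n. C i \<omega>) < real n * x}) \<longlonglongrightarrow> 0"
proof -
  have lim: "(\<lambda>K. expectation (\<lambda>\<omega>. min (C 1 \<omega>) (real K))) \<longlonglongrightarrow> m"
  proof (rule integral_dominated_convergence[where w = "C 1"])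
    show "AE \<omega> in M. (\<lambda>K. min (C 1 \<omega>) (real K)) \<longlonglongrightarrow> C 1 \<omega>"
    proof (rule AE_I2)
      fix \<omega>
      obtain n where "C 1 \<omega> \<le> real n" using real_arch_simple by blast
      then show "(\<lambda>K. min (C 1 \<omega>) (real K)) \<longlonglongrightarrow> C 1 \<omega>"
        by (intro tendsto_eventually eventually_sequentiallyI[of n]) (auto simp: min_def)
    qed
    show "AE \<omega> in M. norm (min (C 1 \<omega>) (real K)) \<le> C 1 \<omega>" for K
      by (rule AE_I2) (use C_nonneg in \<open>auto simp: min_def\<close>)
  qed (auto simp: C_int)
  \<comment> \<open>The condition \<open>1 \<le> K\<close> keeps the range in Hoeffding's inequality
    nondegenerate.\<close>
  have "\<forall>\<^sub>F K in sequentially. x < expectation (\<lambda>\<omega>. min (C 1 \<omega>) (real K)) \<and> 1 \<le> K"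
    using order_tendstoD(1)[OF lim x] eventually_ge_at_top[of 1] by (rule eventually_conj)
  then obtain K :: nat where K: "x < expectation (\<lambda>\<omega>. min (C 1 \<omega>) (real K))" "1 \<le> K"
    by (auto simp: eventually_sequentially)
  define mK where "mK = expectation (\<lambda>\<omega>. min (C 1 \<omega>) (real K))"
  define e where "e = mK - x"
  have e: "0 < e" using K by (simp add: e_def mK_def)
  have expect: "expectation (\<lambda>\<omega>. min (C i \<omega>) (real K)) = mK" if "1 \<le> i" for i
  proof -
    have "expectation (\<lambda>\<omega>. min (C i \<omega>) (real K)) = (\<integral>y. min y (real K) \<partial>distr M borel (C i))"
      by (rule integral_distr[symmetric]) auto
    also have "\<dots> = (\<integral>y. min y (real K) \<partial>distr M borel (C 1))"
      by (simp only: C_ident[OF that])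
    also have "\<dots> = mK" unfolding mK_def by (rule integral_distr) auto
    finally show ?thesis .
  qed
  have bound: "prob {\<omega>\<in>space M. (\<Sum>i=1..n. C i \<omega>) < real n * x} \<le> exp (- (2 * e\<^sup>2 / (real K)\<^sup>2) * real n)"
    if n: "1 \<le> n" for n
  proof -
    interpret H: Hoeffding_ineq M "{1..n}" "\<lambda>i \<omega>. min (C i \<omega>) (real K)" "\<lambda>_. 0" "\<lambda>_. real K"
      "\<Sum>i\<in>{1..n}. expectation (\<lambda>\<omega>. min (C i \<omega>) (real K))"
    proof unfold_locales
      show "indep_vars (\<lambda>_. borel) (\<lambda>i \<omega>. min (C i \<omega>) (real K)) {1..n}"
        by (intro indep_vars_compose2[OF indep_vars_subset[OF C_indep]]) auto
      show "AE \<omega> in M. min (C i \<omega>) (real K) \<in> {0..real K}" for i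
        by (rule AE_I2) (auto simp: C_nonneg)
    qed auto
    have sum: "(\<Sum>i\<in>{1..n}. expectation (\<lambda>\<omega>. min (C i \<omega>) (real K))) = real n * mK"
      by (simp add: expect)
    have "{\<omega>\<in>space M. (\<Sum>i=1..n. C i \<omega>) < real n * x}
        \<subseteq> {\<omega>\<in>space M. (\<Sum>i\<in>{1..n}. min (C i \<omega>) (real K)) \<le> real n * mK - real n * e}"
    proof
      fix \<omega> assume \<omega>: "\<omega> \<in> {\<omega>\<in>space M. (\<Sum>i=1..n. C i \<omega>) < real n * x}"
      have "(\<Sum>i=1..n. min (C i \<omega>) (real K)) \<le> (\<Sum>i=1..n. C i \<omega>)" by (rule sum_mono) simp
      with \<omega> show "\<omega> \<in> {\<omega>\<in>space M. (\<Sum>i\<in>{1..n}. min (C i \<omega>) (real K)) \<le> real n * mK - real n * e}"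
        by (simp add: e_def algebra_simps)
    qed
    then have "prob {\<omega>\<in>space M. (\<Sum>i=1..n. C i \<omega>) < real n * x}
        \<le> prob {\<omega>\<in>space M. (\<Sum>i\<in>{1..n}. min (C i \<omega>) (real K)) \<le> real n * mK - real n * e}"
      by (rule finite_measure_mono) measurable
    also have "\<dots> \<le> exp (-2 * (real n * e)\<^sup>2 / (\<Sum>i\<in>{1..n}. (real K - 0)\<^sup>2))"
      using H.Hoeffding_ineq_le[of "real n * e"] e n K(2) unfolding sum by simp
    also have "-2 * (real n * e)\<^sup>2 / (\<Sum>i\<in>{1..n}. (real K - 0)\<^sup>2) = - (2 * e\<^sup>2 / (real K)\<^sup>2) * real n"
      using n by (simp add: power2_eq_square)
    finally show ?thesis .
  qed
  show ?thesis
  proof (rule tendsto_sandwich[of "\<lambda>_. 0"])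
    have "filterlim (\<lambda>n. - (2 * e\<^sup>2 / (real K)\<^sup>2) * real n) at_bot sequentially"
      using e K(2) by (intro filterlim_tendsto_neg_mult_at_bot[OF tendsto_const _ filterlim_real_sequentially])
        simp
    then show "(\<lambda>n. exp (- (2 * e\<^sup>2 / (real K)\<^sup>2) * real n)) \<longlonglongrightarrow> 0"
      by (rule filterlim_compose[OF exp_at_bot])
    show "\<forall>\<^sub>F n in sequentially. prob {\<omega>\<in>space M. (\<Sum>i=1..n. C i \<omega>) < real n * x}
        \<le> exp (- (2 * e\<^sup>2 / (real K)\<^sup>2) * real n)"
      by (rule eventually_sequentiallyI[of 1], rule bound)
  qed auto
qed

end

context subexponential_claims begin

lemma integrated_tail_increment:
  assumes "0 \<le> a" "a \<le> b"
  shows "m * (T a - T b) \<le> (b - a) * measure B {a<..}"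
proof -
  have "ennreal (T a - T b) = emeasure N {a<..b}"
    using measure_N_Ioc[OF assms(2)] by (simp add: N.emeasure_eq_measure)
  also have "\<dots> = (\<integral>\<^sup>+y. ennreal (measure B {y<..} / m) * indicator {0..} y * indicator {a<..b} y \<partial>lborel)"
    unfolding N_eq_density by (rule emeasure_density) measurable
  also have "\<dots> \<le> (\<integral>\<^sup>+y. ennreal (measure B {a<..} / m) * indicator {a<..b} y \<partial>lborel)"
    using m_pos by (intro nn_integral_mono)
      (auto simp: indicator_def intro!: ennreal_leI divide_right_mono B.finite_measure_mono)
  also have "\<dots> = ennreal (measure B {a<..} / m * (b - a))"
    using assms m_pos by (simp add: nn_integral_cmult ennreal_mult[symmetric])
  finally have "T a - T b \<le> measure B {a<..} / m * (b - a)"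
    using assms m_pos by (subst (asm) ennreal_le_iff) auto
  then show ?thesis using m_pos by (simp add: field_simps)
qed

text \<open>Each claim tail, taken at the left end, dominates its average over the next step of
  length \<open>d\<close>. The averages telescope into integrated tails, which is the origin of the
  factor \<open>m / d\<close> in the lower bound.\<close>

lemma sum_claim_tails:
  assumes d: "0 < d" and w: "0 \<le> w"
  shows "m / d * (T (w + real n0 * d) - T (w + real (n0 + n) * d))
    \<le> (\<Sum>k\<in>{n0..<n0 + n}. measure B {w + real k * d<..})"
proof (induction n)
  case (Suc n)
  have "m * (T (w + real (n0 + n) * d) - T (w + real (n0 + Suc n) * d))
      \<le> d * measure B {w + real (n0 + n) * d<..}"
    using integrated_tail_increment[of "w + real (n0 + n) * d" "w + real (n0 + Suc n) * d"] d w
    by (simp add: algebra_simps)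
  then have "m / d * (T (w + real (n0 + n) * d) - T (w + real (n0 + Suc n) * d))
      \<le> measure B {w + real (n0 + n) * d<..}"
    using d by (simp add: pos_divide_le_eq mult.commute)
  then show ?case using Suc by (simp add: right_diff_distrib)
qed simp

end

context risk_model begin

text \<open>
  One big jump: ruin is caused by claim \<open>n\<close> if the surplus process has followed its mean up to
  then. Keeping the earlier partial sums below \<open>2 * L \<le> u\<close> makes these events disjoint in \<open>n\<close>.
\<close>

lemma ruin_prob_lower_sum:
  fixes L d1 x \<delta> u :: real and n0 n :: nat
  assumes u: "0 < u" "2 * L \<le> u" and x: "x \<le> m" "0 \<le> x" and \<delta>: "\<delta> \<le> 1"
    and n0: "1 \<le> n0"
    and A: "\<And>k. n0 \<le> k \<Longrightarrow> 1 - \<delta> \<le> prob {\<omega>\<in>space M. \<not> L < walk_max c (\<lambda>i. C i \<omega>) (k - 1) 0 \<and>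
        real (k - 1) * x \<le> (\<Sum>i=1..k - 1. C i \<omega>)}"
    and B: "\<And>k. n0 \<le> k \<Longrightarrow> 1 - \<delta> \<le> prob {\<omega>\<in>space M. \<not> (\<exists>i\<in>{1..k}. L \<le> real i * c - p * \<tau> i \<omega>) \<and>
        p * \<tau> k \<omega> \<le> real k * d1}"
  shows "(1 - \<delta>)\<^sup>2 * (\<Sum>k\<in>{n0..<n0 + n}. measure B {u + m + real k * (d1 - x)<..}) \<le> ruin_prob M u p C \<tau>"
proof -
  let ?A = "\<lambda>k y. \<not> L < walk_max c y (k - 1) 0 \<and> real (k - 1) * x \<le> (\<Sum>i=1..k - 1. y i)"
  \<comment> \<open>A jump of this size causes ruin when the earlier claims sum to at least
    \<open>(k - 1) * x\<close> and the premiums so far are at most \<open>k * d1\<close>.\<close>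
  let ?t = "\<lambda>k. u + real k * d1 - real (k - 1) * x"
  let ?B = "\<lambda>k t. \<not> (\<exists>i\<in>{1..k}. L \<le> real i * c - p * t i) \<and> p * t k \<le> real k * d1"
  let ?E = "\<lambda>k. {\<omega>\<in>space M. (?A k (\<lambda>i. C i \<omega>) \<and> ?t k < C k \<omega>) \<and> ?B k (\<lambda>i. \<tau> i \<omega>)}"
  have [measurable]: "(\<lambda>\<omega>. walk_max c (\<lambda>i. C i \<omega>) k 0) \<in> borel_measurable M" for k
    by (rule random_variable_walk_max)
  have walk_restrict: "walk_max c (restrict y {1..}) k 0 = walk_max c y k 0" for y k
    by (rule walk_max_cong) auto
  have E_prob: "(1 - \<delta>)\<^sup>2 * measure B {u + m + real k * (d1 - x)<..} \<le> prob (?E k)" if k: "n0 \<le> k" for k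
  proof -
    have k1: "1 \<le> k" using k n0 by simp
    have [measurable]: "(\<lambda>x. walk_max c x (k - 1) 0) \<in> borel_measurable (Pi\<^sub>M {1..} (\<lambda>_. borel))"
      by (rule measurable_walk_max) auto
    have comp: "(\<lambda>x. x i) \<in> borel_measurable (Pi\<^sub>M {1..} (\<lambda>_. borel :: real measure))"
      if "i \<in> {1..}" for i :: nat
      using that by (rule measurable_component_singleton)
    have [measurable]: "(\<lambda>y. \<Sum>i=1..k - 1. y i) \<in> borel_measurable (Pi\<^sub>M {1..} (\<lambda>_. borel :: real measure))"
      by (intro borel_measurable_sum comp) auto
    have "prob (?E k) = prob {\<omega>\<in>space M. ?A k (\<lambda>i. C i \<omega>) \<and> ?t k < C k \<omega>}
        * prob {\<omega>\<in>space M. ?B k (\<lambda>i. \<tau> i \<omega>)}"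
    proof (rule prob_claims_arrivals)
      show "Measurable.pred (Pi\<^sub>M {1..} (\<lambda>_. borel)) (\<lambda>y. ?A k y \<and> ?t k < y k)"
      proof -
        have [measurable]: "(\<lambda>y. y k) \<in> borel_measurable (Pi\<^sub>M {1..} (\<lambda>_. borel :: real measure))"
          using k1 by (intro comp) simp
        show ?thesis by measurable
      qed
      show "Measurable.pred (Pi\<^sub>M UNIV (\<lambda>_. borel)) (?B k)"
        by measurable
      show "?A k (\<lambda>i\<in>{1..}. C i \<omega>) \<and> ?t k < (\<lambda>i\<in>{1..}. C i \<omega>) k \<longleftrightarrow> ?A k (\<lambda>i. C i \<omega>) \<and> ?t k < C k \<omega>" for \<omega>
        using k1 by (simp add: walk_restrict)
    qed
    also have "prob {\<omega>\<in>space M. ?A k (\<lambda>i. C i \<omega>) \<and> ?t k < C k \<omega>}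
        = prob {\<omega>\<in>space M. ?A k (\<lambda>i. C i \<omega>)} * prob {\<omega>\<in>space M. ?t k < C k \<omega>}"
    proof -
      have "walk_max c (\<lambda>i\<in>{1..<k}. C i \<omega>) (k - 1) 0 = walk_max c (\<lambda>i. C i \<omega>) (k - 1) 0" for \<omega>
        by (rule walk_max_cong) (use k1 in auto)
      moreover have "(\<Sum>i=1..k - 1. (\<lambda>i\<in>{1..<k}. C i \<omega>) i) = (\<Sum>i=1..k - 1. C i \<omega>)" for \<omega>
        by (rule sum.cong) (use k1 in auto)
      ultimately have "?A k (\<lambda>i\<in>{1..<k}. C i \<omega>) \<longleftrightarrow> ?A k (\<lambda>i. C i \<omega>)" for \<omega> by simp
      moreover have "Measurable.pred (Pi\<^sub>M {1..<k} (\<lambda>_. borel)) (?A k)"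
      proof -
        have [measurable]: "(\<lambda>x. walk_max c x (k - 1) 0) \<in> borel_measurable (Pi\<^sub>M {1..<k} (\<lambda>_. borel))"
          by (rule measurable_walk_max) (use k1 in auto)
        have [measurable]: "(\<lambda>y. \<Sum>i=1..k - 1. y i) \<in> borel_measurable (Pi\<^sub>M {1..<k} (\<lambda>_. borel :: real measure))"
          by (intro borel_measurable_sum measurable_component_singleton) (use k1 in auto)
        show ?thesis by measurable
      qed
      ultimately show ?thesis by (intro prob_past_claim k1)
    qed
    also have "prob {\<omega>\<in>space M. ?t k < C k \<omega>} = measure B {?t k<..}"
      by (rule prob_claim_greater[OF k1])
    finally have eq: "prob (?E k) = prob {\<omega>\<in>space M. ?A k (\<lambda>i. C i \<omega>)} * measure B {?t k<..}
        * prob {\<omega>\<in>space M. ?B k (\<lambda>i. \<tau> i \<omega>)}" .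
    \<comment> \<open>Replacing \<open>k - 1\<close> by \<open>k\<close> costs one \<open>x\<close>,
      which the summand \<open>m\<close> covers; the levels then form an arithmetic
      progression.\<close>
    have "real (k - 1) * x = real k * x - x" using k1 by (simp add: of_nat_diff algebra_simps)
    then have "?t k \<le> u + m + real k * (d1 - x)" using x by (simp add: algebra_simps)
    then have "measure B {u + m + real k * (d1 - x)<..} \<le> measure B {?t k<..}"
      by (intro B.finite_measure_mono) auto
    then have "(1 - \<delta>) * measure B {u + m + real k * (d1 - x)<..} * (1 - \<delta>) \<le> prob (?E k)"
      unfolding eq using \<delta> by (intro mult_mono A[OF k] B[OF k] mult_nonneg_nonneg) auto
    then show ?thesis by (simp only: power2_eq_square mult_ac)
  qed
  have E_ruin: "u < (\<Sum>i=1..k. C i \<omega>) - p * \<tau> k \<omega>" if "\<omega> \<in> ?E k" "1 \<le> k" for k \<omega>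
  proof -
    have "(\<Sum>i=1..k. C i \<omega>) = (\<Sum>i=1..k - 1. C i \<omega>) + C k \<omega>"
      using that(2) by (cases k) (auto simp: One_nat_def)
    with that(1) show ?thesis by auto
  qed
  \<comment> \<open>The later event bounds both \<open>S k - k * c\<close> and
    \<open>k * c - p * \<tau> k\<close> by \<open>L\<close>, so the loss at \<open>k\<close> is
    below \<open>2 * L \<le> u\<close>, whereas the earlier event makes it exceed
    \<open>u\<close>.\<close>
  have disj: "?E k \<inter> ?E l = {}" if "k < l" "1 \<le> k" for k l
  proof (rule ccontr)
    assume "?E k \<inter> ?E l \<noteq> {}"
    then obtain \<omega> where \<omega>: "\<omega> \<in> ?E k" "\<omega> \<in> ?E l" by blast
    have "u < (\<Sum>i=1..k. C i \<omega>) - p * \<tau> k \<omega>" using \<omega>(1) that(2) by (rule E_ruin)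
    moreover have "(\<Sum>i=1..k. C i \<omega>) - real k * c \<le> L"
    proof (rule ccontr)
      assume "\<not> ?thesis"
      then have "L < walk_max c (\<lambda>i. C i \<omega>) (l - 1) 0"
        unfolding walk_max_less_iff using that(1) by (intro exI[of _ k]) (auto simp: One_nat_def)
      with \<omega>(2) show False by simp
    qed
    moreover have "real k * c - p * \<tau> k \<omega> < L"
      using \<omega>(2) that by (force simp: not_le)
    ultimately show False using u by simp
  qed
  have meas: "?E k \<in> events" for k by measurable
  have "(1 - \<delta>)\<^sup>2 * (\<Sum>k\<in>{n0..<n0 + n}. measure B {u + m + real k * (d1 - x)<..})
      \<le> (\<Sum>k\<in>{n0..<n0 + n}. prob (?E k))"
    unfolding sum_distrib_left by (intro sum_mono E_prob) simp
  also have "\<dots> = prob (\<Union>k\<in>{n0..<n0 + n}. ?E k)"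
  proof (rule finite_measure_finite_Union[symmetric])
    show "disjoint_family_on ?E {n0..<n0 + n}"
      unfolding disjoint_family_on_def
    proof (intro ballI impI)
      fix k l assume kl: "k \<in> {n0..<n0 + n}" "l \<in> {n0..<n0 + n}" "k \<noteq> l"
      then consider "k < l" | "l < k" by linarith
      then show "?E k \<inter> ?E l = {}"
        using disj[of k l] disj[of l k] kl n0 by cases (auto simp: Int_commute)
    qed
  qed (use meas in auto)
  also have "\<dots> \<le> prob {\<omega>\<in>space M. \<exists>k\<ge>1. u \<le> (\<Sum>i=1..k. C i \<omega>) - p * \<tau> k \<omega>}"
  proof (rule finite_measure_mono)
    show "(\<Union>k\<in>{n0..<n0 + n}. ?E k) \<subseteq> {\<omega>\<in>space M. \<exists>k\<ge>1. u \<le> (\<Sum>i=1..k. C i \<omega>) - p * \<tau> k \<omega>}"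
    proof
      fix \<omega> assume "\<omega> \<in> (\<Union>k\<in>{n0..<n0 + n}. ?E k)"
      then obtain k where k: "k \<in> {n0..<n0 + n}" "\<omega> \<in> ?E k" by blast
      then have "1 \<le> k" using n0 by simp
      with less_imp_le[OF E_ruin[OF k(2)]] k(2) show "\<omega> \<in> {\<omega>\<in>space M. \<exists>k\<ge>1. u \<le> (\<Sum>i=1..k. C i \<omega>) - p * \<tau> k \<omega>}"
        by blast
    qed
  qed measurable
  finally show ?thesis using u by (simp add: ruin_prob_eq)
qed

text \<open>Typically the claims average at least \<open>x\<close> and the premium per claim is at
  most \<open>p / a\<close>, so the level a jump must overcome rises by at most
  \<open>d = p / a - x\<close> per claim. As \<open>a\<close>, \<open>x\<close> and \<delta>
  approach \<mu>, \<open>m\<close> and 0, \<open>m / d\<close> tends to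
  \<open>m / (p / \<mu> - m)\<close>, the desired constant. One factor \<open>1 - \<delta>\<close>
  comes from the claims and one from the arrivals.\<close>

lemma ruin_prob_lower_bound:
  fixes a x \<delta> b :: real
  assumes stable: "\<mu> * m / p < 1" and a: "0 < a" "a < \<mu>" and x: "0 \<le> x" "x < m"
    and \<delta>: "0 < \<delta>" "\<delta> \<le> 1" and b: "b < (1 - \<delta>)\<^sup>2 * (m / (p / a - x))"
  shows "\<forall>\<^sub>F u in at_top. b * T u \<le> ruin_prob M u p C \<tau>"
proof -
  have mu: "0 < \<mu>" using a by simp
  have "m < p / \<mu>" using stable mu p_pos by (simp add: field_simps)
  \<comment> \<open>With \<open>c\<close> strictly between, both the walk of the claims and the
    excess of the arrivals have bounded maxima with high probability; this supplies the level
    \<open>L\<close> for disjointness.\<close>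
  then obtain c where c: "m < c" "c < p / \<mu>" using dense by blast
  have c0: "0 < c" using m_pos c by simp
  have mu_c: "\<mu> < p / c" using c c0 mu by (simp add: field_simps)
  define d where "d = p / a - x"
  have "p / \<mu> < p / a" using a p_pos by (intro divide_strict_left_mono) auto
  then have d: "0 < d" using x \<open>m < p / \<mu>\<close> by (simp add: d_def)
  obtain G D where G: "\<And>n u. prob {\<omega>\<in>space M. u < walk_max c (\<lambda>i. C i \<omega>) n 0} \<le> G u"
    "\<And>x y. x \<le> y \<Longrightarrow> G y \<le> G x" "1 \<le> D" "\<And>u. G u \<le> D * T u"
    "\<forall>\<^sub>F u in at_top. G u \<le> ((m / c) / (1 - m / c) + 1) * T u"
    by (rule walk_max_tail_bound[OF c(1), of "(m / c) / (1 - m / c) + 1"], simp, rule that)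
  obtain K \<kappa> where K: "0 < K" "0 < \<kappa>"
    "\<And>n y. 0 \<le> y \<Longrightarrow> prob {\<omega>\<in>space M. \<exists>k\<in>{1..n}. y \<le> real k * c - p * \<tau> k \<omega>} \<le> K * exp (- \<kappa> * y)"
    using arrival_excess_bound[OF p_pos c0 mu_c] by blast
  have "((\<lambda>L. D * T L) \<longlongrightarrow> D * 0) at_top"
    by (intro tendsto_mult tendsto_const T_at_top)
  then have "\<forall>\<^sub>F L in at_top. D * T L < \<delta> / 2"
    by (rule order_tendstoD) (use \<delta> in simp)
  moreover have "((\<lambda>L. K * exp (- \<kappa> * L)) \<longlongrightarrow> K * 0) at_top"
  proof (intro tendsto_mult tendsto_const filterlim_compose[OF exp_at_bot])
    show "filterlim (\<lambda>L. - \<kappa> * L) at_bot at_top"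
      using K(2) by (intro filterlim_tendsto_neg_mult_at_bot[OF tendsto_const _ filterlim_ident]) simp
  qed
  then have "\<forall>\<^sub>F L in at_top. K * exp (- \<kappa> * L) < \<delta> / 2"
    by (rule order_tendstoD) (use \<delta> in simp)
  ultimately have "\<forall>\<^sub>F L in at_top. D * T L < \<delta> / 2 \<and> K * exp (- \<kappa> * L) < \<delta> / 2 \<and> 0 \<le> L"
    using eventually_ge_at_top[of "0::real"] by eventually_elim simp
  then obtain L where L: "D * T L < \<delta> / 2" "K * exp (- \<kappa> * L) < \<delta> / 2" "0 \<le> L"
    by (auto simp: eventually_at_top_linorder)
  have "\<forall>\<^sub>F k in sequentially. prob {\<omega>\<in>space M. (\<Sum>i=1..k. C i \<omega>) < real k * x} < \<delta> / 2"
    using weak_law_lower[OF x(2)] by (rule order_tendstoD) (use \<delta> in simp)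
  then obtain n1 where n1: "\<And>k. n1 \<le> k \<Longrightarrow> prob {\<omega>\<in>space M. (\<Sum>i=1..k. C i \<omega>) < real k * x} < \<delta> / 2"
    by (auto simp: eventually_sequentially)
  have "\<forall>\<^sub>F k in sequentially. prob {\<omega>\<in>space M. real k / a < \<tau> k \<omega>} < \<delta> / 2"
    using late_arrival_tendsto[OF a] by (rule order_tendstoD) (use \<delta> in simp)
  then obtain n2 where n2: "\<And>k. n2 \<le> k \<Longrightarrow> prob {\<omega>\<in>space M. real k / a < \<tau> k \<omega>} < \<delta> / 2"
    by (auto simp: eventually_sequentially)
  \<comment> \<open>\<open>Suc n1\<close> because the law of large numbers is applied to the
    \<open>k - 1\<close> claims before the jump.\<close>
  define n0 where "n0 = max (Suc n1) (max n2 1)"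
  have [measurable]: "(\<lambda>\<omega>. walk_max c (\<lambda>i. C i \<omega>) k 0) \<in> borel_measurable M" for k
    by (rule random_variable_walk_max)
  have neither: "1 - \<delta> \<le> prob {\<omega>\<in>space M. \<not> P \<omega> \<and> Q \<omega>}"
    if "prob {\<omega>\<in>space M. P \<omega>} < \<delta> / 2" "prob {\<omega>\<in>space M. \<not> Q \<omega>} < \<delta> / 2"
      and [measurable]: "Measurable.pred M P" "Measurable.pred M Q" for P Q
  proof -
    have "prob {\<omega>\<in>space M. \<not> P \<omega> \<and> Q \<omega>} = 1 - prob {\<omega>\<in>space M. \<not> (\<not> P \<omega> \<and> Q \<omega>)}"
      by (subst prob_neg) auto
    moreover have "{\<omega>\<in>space M. \<not> (\<not> P \<omega> \<and> Q \<omega>)} = {\<omega>\<in>space M. P \<omega>} \<union> {\<omega>\<in>space M. \<not> Q \<omega>}"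
      by auto
    moreover have "prob ({\<omega>\<in>space M. P \<omega>} \<union> {\<omega>\<in>space M. \<not> Q \<omega>})
        \<le> prob {\<omega>\<in>space M. P \<omega>} + prob {\<omega>\<in>space M. \<not> Q \<omega>}"
      by (rule measure_Un_le) measurable
    ultimately show ?thesis using that by simp
  qed
  have A: "1 - \<delta> \<le> prob {\<omega>\<in>space M. \<not> L < walk_max c (\<lambda>i. C i \<omega>) (k - 1) 0 \<and>
        real (k - 1) * x \<le> (\<Sum>i=1..k - 1. C i \<omega>)}" if "n0 \<le> k" for k
  proof (rule neither)
    show "prob {\<omega>\<in>space M. L < walk_max c (\<lambda>i. C i \<omega>) (k - 1) 0} < \<delta> / 2"
      using G(1)[of L "k - 1"] G(4)[of L] L(1) by linarith
    have "n1 \<le> k - 1" using that unfolding n0_def by linarith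
    then show "prob {\<omega>\<in>space M. \<not> real (k - 1) * x \<le> (\<Sum>i=1..k - 1. C i \<omega>)} < \<delta> / 2"
      using n1[of "k - 1"] by (simp add: not_le)
  qed measurable
  have B: "1 - \<delta> \<le> prob {\<omega>\<in>space M. \<not> (\<exists>i\<in>{1..k}. L \<le> real i * c - p * \<tau> i \<omega>) \<and>
        p * \<tau> k \<omega> \<le> real k * (p / a)}" if "n0 \<le> k" for k
  proof (rule neither)
    show "prob {\<omega>\<in>space M. \<exists>i\<in>{1..k}. L \<le> real i * c - p * \<tau> i \<omega>} < \<delta> / 2"
      using K(3)[OF L(3), of k] L(2) by linarith
    have "p * \<tau> k \<omega> \<le> real k * (p / a) \<longleftrightarrow> \<not> real k / a < \<tau> k \<omega>" for \<omega>
      using p_pos a by (simp add: not_less field_simps)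
    then show "prob {\<omega>\<in>space M. \<not> p * \<tau> k \<omega> \<le> real k * (p / a)} < \<delta> / 2"
      using n2[of k] that by (simp add: n0_def)
  qed measurable
  have lower: "(1 - \<delta>)\<^sup>2 * (m / d) * T (u + (m + real n0 * d)) \<le> ruin_prob M u p C \<tau>"
    if u: "0 < u" "2 * L \<le> u" for u
  proof -
    have le: "(1 - \<delta>)\<^sup>2 * (m / d) * (T (u + (m + real n0 * d)) - T (u + m + real (n0 + n) * d)) \<le> ruin_prob M u p C \<tau>" for n
    proof -
      have "(1 - \<delta>)\<^sup>2 * (m / d * (T (u + m + real n0 * d) - T (u + m + real (n0 + n) * d)))
          \<le> (1 - \<delta>)\<^sup>2 * (\<Sum>k\<in>{n0..<n0 + n}. measure B {u + m + real k * d<..})"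
        using u m_pos by (intro mult_left_mono sum_claim_tails d) auto
      also have "\<dots> \<le> ruin_prob M u p C \<tau>"
        unfolding d_def using u x \<delta>
        by (intro ruin_prob_lower_sum[where L = L and c = c] A B) (auto simp: n0_def)
      finally show ?thesis by (simp add: mult.assoc add.assoc)
    qed
    have "filterlim (\<lambda>n. u + m + real (n0 + n) * d) at_top sequentially"
    proof (rule filterlim_tendsto_add_at_top[OF tendsto_const])
      show "filterlim (\<lambda>n. real (n0 + n) * d) at_top sequentially"
        by (rule filterlim_at_top_mult_tendsto_pos[OF tendsto_const d],
            rule filterlim_compose[OF filterlim_real_sequentially])
          (simp add: filterlim_at_top eventually_sequentially; metis trans_le_add2)
    qed
    then have "(\<lambda>n. T (u + m + real (n0 + n) * d)) \<longlonglongrightarrow> 0"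
      by (rule filterlim_compose[OF T_at_top])
    then have "(\<lambda>n. (1 - \<delta>)\<^sup>2 * (m / d) * (T (u + (m + real n0 * d)) - T (u + m + real (n0 + n) * d)))
        \<longlonglongrightarrow> (1 - \<delta>)\<^sup>2 * (m / d) * (T (u + (m + real n0 * d)) - 0)"
      by (intro tendsto_mult tendsto_const tendsto_diff)
    then have "(1 - \<delta>)\<^sup>2 * (m / d) * (T (u + (m + real n0 * d)) - 0) \<le> ruin_prob M u p C \<tau>"
      by (rule tendsto_upperbound[OF _ always_eventually[OF allI[OF le]]]) simp
    then show ?thesis by simp
  qed
  define s where "s = m + real n0 * d"
  have s: "0 \<le> s" using m_pos d by (simp add: s_def)
  have "((\<lambda>u. T (u + s) / T (u + s - s)) \<longlongrightarrow> inverse 1) at_top"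
  proof -
    have "filterlim (\<lambda>u. u + s) at_top at_top"
      unfolding filterlim_at_top eventually_at_top_linorder by (metis diff_le_eq)
    from tendsto_inverse[OF filterlim_compose[OF long_tailed[OF s] this]]
    show ?thesis by simp
  qed
  then have "((\<lambda>u. (1 - \<delta>)\<^sup>2 * (m / d) * (T (u + s) / T u)) \<longlongrightarrow> (1 - \<delta>)\<^sup>2 * (m / d) * 1) at_top"
    by (intro tendsto_mult tendsto_const) simp
  then have "\<forall>\<^sub>F u in at_top. b < (1 - \<delta>)\<^sup>2 * (m / d) * (T (u + s) / T u)"
    by (rule order_tendstoD) (use b in \<open>simp add: d_def\<close>)
  then show ?thesis
    using eventually_gt_at_top[of 0] eventually_ge_at_top[of "2 * L"]
  proof eventually_elim
    case (elim u)
    have "b * T u \<le> (1 - \<delta>)\<^sup>2 * (m / d) * (T (u + s) / T u) * T u"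
      using elim(1) by (intro mult_right_mono T_nonneg) simp
    also have "\<dots> = (1 - \<delta>)\<^sup>2 * (m / d) * T (u + s)"
      using T_pos[of u] by simp
    also have "\<dots> \<le> ruin_prob M u p C \<tau>"
      using lower[OF elim(2,3)] by (simp add: s_def)
    finally show ?case .
  qed
qed

section \<open>Letting the approximation parameters tend to their limits\<close>

theorem ruin_prob_asymp:
  assumes stable: "\<mu> * m / p < 1"
  shows "((\<lambda>u. ruin_prob M u p C \<tau> / T u) \<longlongrightarrow> (\<mu> * m / p) / (1 - \<mu> * m / p)) at_top"
proof (rule order_tendstoI)
  fix b assume b: "(\<mu> * m / p) / (1 - \<mu> * m / p) < b"
  obtain b1 where b1: "(\<mu> * m / p) / (1 - \<mu> * m / p) < b1" "b1 < b" using dense[OF b] by blast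
  let ?r = "\<lambda>e. (\<mu> + e) * m / p"
  have r: "(?r \<longlongrightarrow> (\<mu> + 0) * m / p) (at_right 0)"
    using p_pos by (intro tendsto_intros) auto
  have "((\<lambda>e. ?r e / (1 - ?r e)) \<longlongrightarrow> ((\<mu> + 0) * m / p) / (1 - (\<mu> + 0) * m / p)) (at_right 0)"
    using less_imp_neq[OF stable]
    by (intro tendsto_divide[OF r tendsto_diff[OF tendsto_const r]]) (metis add_0_right right_minus_eq)
  then have "\<forall>\<^sub>F e in at_right 0. ?r e / (1 - ?r e) < b1"
    by (rule order_tendstoD) (use b1 in simp)
  moreover have "\<forall>\<^sub>F e in at_right 0. ?r e < 1"
    using r by (rule order_tendstoD) (use stable in simp)
  ultimately have "\<forall>\<^sub>F e in at_right 0. ?r e / (1 - ?r e) < b1 \<and> ?r e < 1 \<and> 0 < e"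
    using eventually_at_right_less[of "0::real"] by eventually_elim simp
  then obtain e where e: "?r e / (1 - ?r e) < b1" "?r e < 1" "0 < e"
    using eventually_happens[of _ "at_right (0::real)"] by auto
  \<comment> \<open>The arrival intensity is raised slightly: \<open>m / c\<close> is the load at
    intensity \<open>\<mu> + e\<close>. As \<open>e\<close> is positive, the spacing
    \<open>p / e2\<close> makes sense even for \<open>\<mu> = 0\<close>.\<close>
  define e2 where "e2 = \<mu> + e"
  define c where "c = p / e2"
  have e2: "0 < e2" "\<mu> < e2" using e(3) mu_nonneg by (auto simp: e2_def)
  have mc: "m / c = ?r e" by (simp add: c_def e2_def mult.commute)
  have "0 < c" using p_pos e2 by (simp add: c_def)
  then have "m < c" using e(2) unfolding mc[symmetric] by (simp add: divide_less_eq)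
  moreover have "\<mu> < p / c" using e2 p_pos by (simp add: c_def)
  ultimately have "\<forall>\<^sub>F u in at_top. ruin_prob M u p C \<tau> \<le> b1 * T u"
    using e(1) by (intro ruin_prob_upper_bound[of c]) (simp_all add: mc)
  then show "\<forall>\<^sub>F u in at_top. ruin_prob M u p C \<tau> / T u < b"
  proof eventually_elim
    case (elim u)
    then have "ruin_prob M u p C \<tau> / T u \<le> b1" using T_pos[of u] by (simp add: divide_le_eq)
    then show ?case using b1 by simp
  qed
next
  fix b assume b: "b < (\<mu> * m / p) / (1 - \<mu> * m / p)"
  show "\<forall>\<^sub>F u in at_top. b < ruin_prob M u p C \<tau> / T u"
  \<comment> \<open>For \<open>\<mu> = 0\<close> no \<open>a\<close> lies strictly between 0 and
    \<mu>, but the limit is 0 and nonnegativity of the ruin probability suffices.\<close>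
  proof (cases "\<mu> = 0")
    case True
    then have "b < 0" using b by simp
    then show ?thesis
      by (auto intro!: always_eventually order.strict_trans2[OF _ divide_nonneg_nonneg] simp: ruin_prob_def T_nonneg)
  next
    case False
    then have mu: "0 < \<mu>" using mu_nonneg by simp
    obtain b1 where b1: "b1 < (\<mu> * m / p) / (1 - \<mu> * m / p)" "b < b1" using dense[OF b] by blast
    have "m < p / \<mu>" using stable mu p_pos by (simp add: field_simps)
    \<comment> \<open>One \<open>e\<close> drives all parameters: \<open>a = \<mu> - e\<close>,
      \<open>x = m - e\<close> and \<open>\<delta> = e\<close>. The limit is written as the value at
      \<open>e = 0\<close>, ready for continuity.\<close>
    have "(\<mu> * m / p) / (1 - \<mu> * m / p) = (1 - 0)\<^sup>2 * (m / (p / (\<mu> - 0) - (m - 0)))"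
      using mu p_pos stable \<open>m < p / \<mu>\<close> by (simp add: field_simps)
    moreover have "((\<lambda>e. (1 - e)\<^sup>2 * (m / (p / (\<mu> - e) - (m - e))))
        \<longlongrightarrow> (1 - 0)\<^sup>2 * (m / (p / (\<mu> - 0) - (m - 0)))) (at_right 0)"
      using mu \<open>m < p / \<mu>\<close> by (intro tendsto_intros) auto
    ultimately have "\<forall>\<^sub>F e in at_right 0. b1 < (1 - e)\<^sup>2 * (m / (p / (\<mu> - e) - (m - e)))"
      using b1 by (intro order_tendstoD) auto
    moreover have "\<forall>\<^sub>F e in at_right 0. e < Min {\<mu>, m, 1}"
      using mu m_pos by (intro eventually_at_rightI[of 0 "Min {\<mu>, m, 1}"]) auto
    ultimately have "\<forall>\<^sub>F e in at_right 0. b1 < (1 - e)\<^sup>2 * (m / (p / (\<mu> - e) - (m - e)))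
        \<and> e < Min {\<mu>, m, 1} \<and> 0 < e"
      using eventually_at_right_less[of "0::real"] by eventually_elim simp
    then obtain e where e: "b1 < (1 - e)\<^sup>2 * (m / (p / (\<mu> - e) - (m - e)))" "e < \<mu>" "e < m" "e < 1" "0 < e"
      using eventually_happens[of _ "at_right (0::real)"] by auto
    have "\<forall>\<^sub>F u in at_top. b1 * T u \<le> ruin_prob M u p C \<tau>"
      using e by (intro ruin_prob_lower_bound[OF stable, of "\<mu> - e" "m - e" e]) auto
    then show ?thesis
    proof eventually_elim
      case (elim u)
      then have "b1 \<le> ruin_prob M u p C \<tau> / T u" using T_pos[of u] by (simp add: le_divide_eq)
      then show ?case using b1 by simp
    qed
  qed
qed

end

theorem theorem1:
  fixes M :: "'a measure" and C \<tau> :: "nat \<Rightarrow> 'a \<Rightarrow> real"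
    and p \<mu> :: real and I :: "real \<Rightarrow> ereal"
  assumes M: "prob_space M"
    and p_pos: "p > 0"
    \<comment> \<open>claims: i.i.d., nonnegative, integrable\<close>
    and C_rv: "\<And>i. C i \<in> borel_measurable M"
    and C_indep: "prob_space.indep_vars M (\<lambda>_. borel) C {1..}"
    and C_ident: "\<And>i. i \<ge> 1 \<Longrightarrow> distr M borel (C i) = distr M borel (C 1)"
    and C_nonneg: "\<And>i \<omega>. \<omega> \<in> space M \<Longrightarrow> C i \<omega> \<ge> 0"
    and C_int: "integrable M (C 1)"
    \<comment> \<open>simple point process with N_0 = 0 given by its arrival times\<close>
    and tau_rv: "\<And>i. \<tau> i \<in> borel_measurable M"
    and tau0: "\<And>\<omega>. \<omega> \<in> space M \<Longrightarrow> \<tau> 0 \<omega> = 0"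
    and tau_strict: "\<And>i \<omega>. \<omega> \<in> space M \<Longrightarrow> \<tau> i \<omega> < \<tau> (Suc i) \<omega>"
    and tau_infty: "\<And>\<omega>. \<omega> \<in> space M \<Longrightarrow> filterlim (\<lambda>i. \<tau> i \<omega>) at_top sequentially"
    \<comment> \<open>claims independent of the point process\<close>
    and indep_C_N: "prob_space.indep_var M
        (Pi\<^sub>M {1..} (\<lambda>_. borel)) (\<lambda>\<omega>. \<lambda>i\<in>{1..}. C i \<omega>)
        (Pi\<^sub>M UNIV (\<lambda>_. borel)) (\<lambda>\<omega> i. \<tau> i \<omega>)"
    \<comment> \<open>Assumption A1\<close>
    and A1_i: "LDP M (\<lambda>t \<omega>. real (count_proc \<tau> t \<omega>) / t) I"
    and A1_i0: "\<And>x. I x = 0 \<longleftrightarrow> x = \<mu>"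
    and A1_ii_up: "mono_on {\<mu>..} I"
    and A1_ii_down: "antimono_on {0..\<mu>} I"
    and A1_iii: "\<mu> * (\<integral>\<omega>. C 1 \<omega> \<partial>M) / p < 1"
    and A1_iv: "\<exists>\<theta>>0. \<forall>n. integrable M (\<lambda>\<omega>. exp (\<theta> * (\<Sum>i = 1..n. interarrival \<tau> i \<omega>)))"
    \<comment> \<open>B_0 subexponential\<close>
    and B0_S: "subexponential (integrated_tail M C)"
  shows "((\<lambda>u. ruin_prob M u p C \<tau> / tail (integrated_tail M C) u)
           \<longlongrightarrow> (\<mu> * (\<integral>\<omega>. C 1 \<omega> \<partial>M) / p) / (1 - \<mu> * (\<integral>\<omega>. C 1 \<omega> \<partial>M) / p)) at_top"
proof -
  interpret prob_space M by (rule M)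
  interpret R: risk_model M C \<tau> I \<mu> p
  proof unfold_locales
    show "mono_on {\<mu>..} I" "antimono_on {0..\<mu>} I" by (rule A1_ii_up A1_ii_down)+
  qed (fact C_rv C_indep C_ident C_nonneg C_int B0_S tau_rv tau0 tau_strict tau_infty A1_i A1_i0
      p_pos indep_C_N)+
  show ?thesis using A1_iii by (rule R.ruin_prob_asymp)
qed

end
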